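(* Let $G$ be a bridgeless graph. Then: (1) $\phi_{2,p}(G)\le 3$ for every $p\in[1,\infty]$; (2) $\phi_{3,p}(G)\le 1+2^{1/p}$ for every $p\in[1,\infty]$ (with $2^{1/\infty}=1$), and in particular $\phi_{3,\infty}(G)=2$; (3) $\phi_{3,1}(G)\le \frac{9}{4}$.
   Context: All graphs are finite and may have multiple edges but no loops. For an orientation $D$ of a graph $G$ and a vertex $v$, $E_D^+(v)$ and $E_D^-(v)$ denote the sets of edges directed out of and into $v$. For $\Omega\subseteq\mathbb{R}^d$, a vector $\Omega$-flow of $G$ is a pair $(D,f)$ where $D$ is an orientation of $G$ and $f:E(G)\to\Omega$ satisfies $\sum_{e\in E_D^+(v)}f(e)-\sum_{e\in E_D^-(v)}f(e)=\mathbf{0}$ for every vertex $v$. For $p\in[1,\infty)$, $\|x\|_p=(|x_1|^p+\dots+|x_d|^p)^{1/p}$ and $\|x\|_\infty=\max_i|x_i|$. For an integer $d\ge1$, a real $r\ge 2$ and $p\in[1,\infty]$, a $d$-dimensional $p$-normed nowhere-zero $r$-flow (an $(r,d,p)$-NZF) of $G$ is a vector $(\mathbb{R}^d\setminus\{\mathbf{0}\})$-flow $(D,f)$ with $1\le\|f(e)\|_p\le r-1$ for every edge $e$. For a bridgeless graph $G$, $\phi_{d,p}(G)$ is the infimum of all real $r$ for which $G$ admits an $(r,d,p)$-NZF. *)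

theory Defs
  imports "HOL-Analysis.Analysis" "Graph_Theory.Digraph"
begin

text \<open>
  Undirected multigraphs: each edge is mapped to its set of end vertices. Requiring this set to
  have exactly two elements excludes loops, while distinct edges may share the same ends.
\<close>

record ('v, 'e) mgraph =
  vertices :: "'v set"
  edges :: "'e set"
  ends :: "'e \<Rightarrow> 'v set"

definition multigraph :: "('v, 'e) mgraph \<Rightarrow> bool" where
  "multigraph G \<longleftrightarrow> finite (vertices G) \<and> finite (edges G) \<and>
     (\<forall>e\<in>edges G. ends G e \<subseteq> vertices G \<and> card (ends G e) = 2)"

definition adjacent :: "('v, 'e) mgraph \<Rightarrow> ('v \<times> 'v) set" where
  "adjacent G = {(u, v). \<exists>e\<in>edges G. ends G e = {u, v}}"

definition connection :: "('v, 'e) mgraph \<Rightarrow> ('v \<times> 'v) set" where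
  "connection G = (adjacent G)\<^sup>* \<inter> vertices G \<times> vertices G"

definition mgraph_components :: "('v, 'e) mgraph \<Rightarrow> 'v set set" where
  "mgraph_components G = vertices G // connection G"

definition delete_edge :: "('v, 'e) mgraph \<Rightarrow> 'e \<Rightarrow> ('v, 'e) mgraph" where
  "delete_edge G e = G\<lparr>edges := edges G - {e}\<rparr>"

definition is_bridge :: "('v, 'e) mgraph \<Rightarrow> 'e \<Rightarrow> bool" where
  "is_bridge G e \<longleftrightarrow> e \<in> edges G \<and>
     card (mgraph_components (delete_edge G e)) > card (mgraph_components G)"

text \<open>Bridgeless graphs need not be connected.\<close>

definition bridgeless :: "('v, 'e) mgraph \<Rightarrow> bool" where
  "bridgeless G \<longleftrightarrow> (\<forall>e\<in>edges G. \<not> is_bridge G e)"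

text \<open>
  An orientation is a digraph on the same vertices and edges, so that \<^const>\<open>out_arcs\<close> and
  \<^const>\<open>in_arcs\<close> are the sets of edges directed out of and into a vertex.
\<close>

definition orientation :: "('v, 'e) mgraph \<Rightarrow> ('v, 'e) pre_digraph \<Rightarrow> bool" where
  "orientation G D \<longleftrightarrow> verts D = vertices G \<and> arcs D = edges G \<and>
     (\<forall>e\<in>edges G. {tail D e, head D e} = ends G e)"

definition vector_flow ::
  "(real ^ 'd) set \<Rightarrow> ('v, 'e) mgraph \<Rightarrow> ('v, 'e) pre_digraph \<Rightarrow> ('e \<Rightarrow> real ^ 'd) \<Rightarrow> bool" where
  "vector_flow \<Omega> G D f \<longleftrightarrow> orientation G D \<and> (\<forall>e\<in>edges G. f e \<in> \<Omega>) \<and>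
     (\<forall>v\<in>vertices G. (\<Sum>e\<in>out_arcs D v. f e) - (\<Sum>e\<in>in_arcs D v. f e) = 0)"

definition p_norm :: "ereal \<Rightarrow> real ^ 'd \<Rightarrow> real" where
  "p_norm p x =
     (if p = \<infinity> then (MAX i. \<bar>x $ i\<bar>)
      else (\<Sum>i\<in>UNIV. \<bar>x $ i\<bar> powr real_of_ereal p) powr (1 / real_of_ereal p))"

text \<open>The dimension $d$ is the cardinality of the index type \<^typ>\<open>'d\<close>.\<close>

definition nzf ::
  "real \<Rightarrow> ereal \<Rightarrow> ('v, 'e) mgraph \<Rightarrow> ('v, 'e) pre_digraph \<Rightarrow> ('e \<Rightarrow> real ^ 'd) \<Rightarrow> bool" where
  "nzf r p G D f \<longleftrightarrow> r \<ge> 2 \<and> vector_flow (UNIV - {0}) G D f \<and>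
     (\<forall>e\<in>edges G. 1 \<le> p_norm p (f e) \<and> p_norm p (f e) \<le> r - 1)"

text \<open>
  The infimum is taken in the extended reals, so that it is \<open>\<infinity>\<close> (and not an unspecified real)
  if the graph has no such flow for any \<open>r\<close>.
\<close>

definition flow_index :: "'d::finite itself \<Rightarrow> ereal \<Rightarrow> ('v, 'e) mgraph \<Rightarrow> ereal" where
  "flow_index _ p G =
     Inf {ereal r | r. \<exists>D (f :: 'e \<Rightarrow> real ^ 'd). nzf r p G D f}"

end

theory Submission
  imports Defs
begin

text \<open>
  Following Seymour, a bridgeless graph carries a flow modulo 2 and a flow modulo 3 such that no
  edge is zero in both. Lifting them to the integers turns the pair into three integral flows
  \<open>a\<close>, \<open>p\<close>, \<open>q\<close> such that \<open>a\<close>, \<open>p\<close>, \<open>q\<close> and \<open>p - q\<close> take values in \<open>{-1, 0, 1}\<close> and no edge is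
  zero in all three. For vectors \<open>x\<close>, \<open>y\<close>, \<open>z\<close>, the flow \<open>a x + p y + q z\<close> then takes, up to sign,
  only the values \<open>x\<close> and \<open>y\<close>, \<open>z\<close>, \<open>y + z\<close>, each of the latter also with \<open>x\<close> added or subtracted.
  In the plane, let \<open>x\<close>, \<open>y\<close> and \<open>z = y - x\<close> be unit vectors, the sides of an equilateral triangle;
  by the triangle inequality all norms are between 1 and 2. In space, let \<open>y\<close>, \<open>z\<close>, \<open>y + z\<close> be unit
  vectors in a coordinate plane and \<open>x\<close> the remaining basis vector.
\<close>

section \<open>Flows and cuts\<close>

text \<open>Tails and heads are explicit maps, so that contracting vertices is composition with a
  vertex map; the loops this creates contribute nothing.\<close>

definition outflow :: "'e set \<Rightarrow> ('e \<Rightarrow> 'v) \<Rightarrow> ('e \<Rightarrow> 'v) \<Rightarrow> ('e \<Rightarrow> int) \<Rightarrow> 'v set \<Rightarrow> int" where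
  "outflow E t h f X = (\<Sum>e\<in>E. f e * (of_bool (t e \<in> X) - of_bool (h e \<in> X)))"

definition cut_edges :: "'e set \<Rightarrow> ('e \<Rightarrow> 'v) \<Rightarrow> ('e \<Rightarrow> 'v) \<Rightarrow> 'v set \<Rightarrow> 'e set" where
  "cut_edges E t h X = {e \<in> E. t e \<in> X \<longleftrightarrow> h e \<notin> X}"

text \<open>Conservation is asked of every vertex set, so that no vertex set has to be named and
  contraction just passes to preimages.\<close>

definition mod_flow :: "int \<Rightarrow> 'e set \<Rightarrow> ('e \<Rightarrow> 'v) \<Rightarrow> ('e \<Rightarrow> 'v) \<Rightarrow> ('e \<Rightarrow> int) \<Rightarrow> bool" where
  "mod_flow k E t h f \<longleftrightarrow> (\<forall>X. k dvd outflow E t h f X)"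

lemma outflow_cong:
  "(\<And>e. e \<in> E \<Longrightarrow> (t e \<in> X \<longleftrightarrow> h e \<notin> X) \<Longrightarrow> f e = g e) \<Longrightarrow>
    outflow E t h f X = outflow E t h g X"
  unfolding outflow_def by (rule sum.cong) auto

lemma outflow_add: "outflow E t h (\<lambda>e. f e + g e) X = outflow E t h f X + outflow E t h g X"
  by (simp add: outflow_def sum.distrib distrib_right)

lemma outflow_cmult: "outflow E t h (\<lambda>e. c * f e) X = c * outflow E t h f X"
  by (simp add: outflow_def sum_distrib_left mult.assoc)

lemma outflow_minus: "outflow E t h (\<lambda>e. - f e) X = - outflow E t h f X"
  using outflow_cmult[of E t h "-1" f X] by simp

lemma outflow_diff: "outflow E t h (\<lambda>e. f e - g e) X = outflow E t h f X - outflow E t h g X"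
  using outflow_add[of E t h f "\<lambda>e. - g e" X] by (simp add: outflow_minus)

lemma outflow_dvd_diff:
  assumes "\<And>e. e \<in> E \<Longrightarrow> k dvd f e - g e"
  shows "k dvd outflow E t h f X - outflow E t h g X"
  unfolding outflow_diff[symmetric] unfolding outflow_def using assms by (auto intro: dvd_sum)

lemma outflow_single:
  assumes "finite E" "e \<in> E"
  shows "outflow E t h (\<lambda>x. if x = e then c else 0) X = c * (of_bool (t e \<in> X) - of_bool (h e \<in> X))"
proof -
  have "outflow E t h (\<lambda>x. if x = e then c else 0) X =
      (\<Sum>x\<in>E. if x = e then c * (of_bool (t e \<in> X) - of_bool (h e \<in> X)) else 0)"
    unfolding outflow_def by (rule sum.cong) auto
  then show ?thesis using assms by simp
qed

lemma outflow_Un: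
  assumes "finite E" "X \<inter> Y = {}"
  shows "outflow E t h f (X \<union> Y) = outflow E t h f X + outflow E t h f Y"
proof -
  have "f e * (of_bool (t e \<in> X \<union> Y) - of_bool (h e \<in> X \<union> Y)) =
    f e * (of_bool (t e \<in> X) - of_bool (h e \<in> X)) + f e * (of_bool (t e \<in> Y) - of_bool (h e \<in> Y))" for e
    using assms(2) by (auto simp: algebra_simps)
  then show ?thesis unfolding outflow_def by (simp add: sum.distrib)
qed

lemma outflow_sum_singletons:
  assumes "finite E" "finite X"
  shows "outflow E t h f X = (\<Sum>v\<in>X. outflow E t h f {v})"
  using assms(2)
proof (induction X rule: finite_induct)
  case empty
  then show ?case by (simp add: outflow_def)
next
  case (insert x X)
  then show ?case using outflow_Un[OF assms(1), of "{x}" X t h f] by simp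
qed

lemma outflow_comp: "outflow E (\<pi> \<circ> t) (\<pi> \<circ> h) f X = outflow E t h f (\<pi> -` X)"
  by (simp add: outflow_def)

lemma cut_edges_comp: "cut_edges E (\<pi> \<circ> t) (\<pi> \<circ> h) X = cut_edges E t h (\<pi> -` X)"
  by (simp add: cut_edges_def)

lemma outflow_Int:
  assumes "t ` E \<subseteq> V" "h ` E \<subseteq> V"
  shows "outflow E t h f (X \<inter> V) = outflow E t h f X"
  unfolding outflow_def using assms by (intro sum.cong) auto

lemma cut_edges_Int:
  assumes "t ` E \<subseteq> V" "h ` E \<subseteq> V"
  shows "cut_edges E t h (X \<inter> V) = cut_edges E t h X"
  unfolding cut_edges_def using assms by auto

lemma outflow_all:
  assumes "t ` E \<subseteq> V" "h ` E \<subseteq> V"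
  shows "outflow E t h f V = 0"
  unfolding outflow_def using assms by (intro sum.neutral) auto

lemma mod_flowI:
  assumes "finite E" "finite V" "t ` E \<subseteq> V" "h ` E \<subseteq> V"
    and "\<And>v. v \<in> V \<Longrightarrow> k dvd outflow E t h f {v}"
  shows "mod_flow k E t h f"
  unfolding mod_flow_def
proof
  fix X
  have "outflow E t h f X = (\<Sum>v\<in>X \<inter> V. outflow E t h f {v})"
    using outflow_Int[OF assms(3,4), of f X] outflow_sum_singletons[OF assms(1), of "X \<inter> V"] assms(2)
    by simp
  then show "k dvd outflow E t h f X" using assms(5) by (auto intro: dvd_sum)
qed

section \<open>Integral flows with demands and capacities\<close>

text \<open>The largest net outflow of \<open>X\<close> that the bounds permit, as in Hoffman's
  circulation theorem.\<close>

definition capacity ::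
  "'e set \<Rightarrow> ('e \<Rightarrow> 'v) \<Rightarrow> ('e \<Rightarrow> 'v) \<Rightarrow> ('e \<Rightarrow> int) \<Rightarrow> ('e \<Rightarrow> int) \<Rightarrow> 'v set \<Rightarrow> int" where
  "capacity E t h lo hi X =
     (\<Sum>e\<in>E. hi e * of_bool (t e \<in> X \<and> h e \<notin> X) - lo e * of_bool (t e \<notin> X \<and> h e \<in> X))"

text \<open>Submodularity of cuts with a surplus: \<open>e0\<close> counts \<open>hi e0\<close> for
  \<open>X\<close> and \<open>- lo e0\<close> for \<open>Y\<close>, but nothing for
  \<open>X \<inter> Y\<close> and \<open>X \<union> Y\<close>.\<close>

lemma capacity_submodular:
  assumes "finite E" "\<And>e. e \<in> E \<Longrightarrow> lo e \<le> hi e"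
    and "e0 \<in> E" "t e0 \<in> X" "h e0 \<notin> X" "t e0 \<notin> Y" "h e0 \<in> Y"
  shows "capacity E t h lo hi (X \<inter> Y) + capacity E t h lo hi (X \<union> Y) + (hi e0 - lo e0)
    \<le> capacity E t h lo hi X + capacity E t h lo hi Y"
proof -
  define c where "c e Z = hi e * of_bool (t e \<in> Z \<and> h e \<notin> Z) - lo e * of_bool (t e \<notin> Z \<and> h e \<in> Z)" for e Z
  have cap: "capacity E t h lo hi Z = (\<Sum>e\<in>E. c e Z)" for Z
    by (simp add: capacity_def c_def)
  have delta: "(\<Sum>e\<in>E. if e = e0 then hi e0 - lo e0 else 0) = hi e0 - lo e0"
    using assms(1,3) by simp
  have "(\<Sum>e\<in>E. c e (X \<inter> Y) + c e (X \<union> Y) + (if e = e0 then hi e0 - lo e0 else 0))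
     \<le> (\<Sum>e\<in>E. c e X + c e Y)"
  proof (rule sum_mono)
    fix e assume "e \<in> E"
    then have "lo e \<le> hi e" by (rule assms(2))
    then show "c e (X \<inter> Y) + c e (X \<union> Y) + (if e = e0 then hi e0 - lo e0 else 0) \<le> c e X + c e Y"
      using assms(4-7)
      by (cases "t e \<in> X"; cases "h e \<in> X"; cases "t e \<in> Y"; cases "h e \<in> Y") (auto simp: c_def)
  qed
  then show ?thesis by (simp add: cap sum.distrib delta)
qed

lemma capacity_update:
  assumes "finite E" "e0 \<in> E"
  shows "capacity E t h lo (hi(e0 := hi e0 - 1)) X =
      capacity E t h lo hi X - of_bool (t e0 \<in> X \<and> h e0 \<notin> X)"
    and "capacity E t h (lo(e0 := lo e0 + 1)) hi X =
      capacity E t h lo hi X - of_bool (t e0 \<notin> X \<and> h e0 \<in> X)"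
  unfolding capacity_def using assms by (simp_all add: sum.remove[OF assms] algebra_simps)

text \<open>
  An edge with slack can be tightened at one of its two ends without violating the cut condition:
  otherwise a tight set left by the edge and a tight set entered by it could be uncrossed.
\<close>

theorem feasible_flow:
  assumes "finite E" "finite V" "t ` E \<subseteq> V" "h ` E \<subseteq> V"
    and "\<And>e. e \<in> E \<Longrightarrow> lo e \<le> hi e"
    and "(\<Sum>v\<in>V. d v) = 0"
    and "\<And>X. X \<subseteq> V \<Longrightarrow> (\<Sum>v\<in>X. d v) \<le> capacity E t h lo hi X"
  obtains m where "\<And>e. e \<in> E \<Longrightarrow> lo e \<le> m e \<and> m e \<le> hi e"
    and "\<And>v. v \<in> V \<Longrightarrow> outflow E t h m {v} = d v"
proof -
  have "\<exists>m. (\<forall>e\<in>E. lo e \<le> m e \<and> m e \<le> hi e) \<and> (\<forall>v\<in>V. outflow E t h m {v} = d v)"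
    using assms(5,7)
  \<comment> \<open>Induction on the total slack, which drops by one whenever an edge is
    tightened.\<close>
  proof (induction "nat (\<Sum>e\<in>E. hi e - lo e)" arbitrary: lo hi rule: less_induct)
    case less
    show ?case
    proof (cases "\<exists>e\<in>E. lo e < hi e")
      case False
      then have eq: "lo e = hi e" if "e \<in> E" for e using that less.prems(1) by force
      have cap: "capacity E t h lo hi X = outflow E t h lo X" for X
        unfolding capacity_def outflow_def by (rule sum.cong) (auto simp: eq)
      \<comment> \<open>With no slack left, \<open>lo\<close> is the only candidate. Singletons give
        an inequality at every vertex, and both sides have total 0, so equality holds
        throughout.\<close>
      have ge: "d v \<le> outflow E t h lo {v}" if "v \<in> V" for v
        using less.prems(2)[of "{v}"] that cap by simp
      have "(\<Sum>v\<in>V. outflow E t h lo {v} - d v) = 0"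
        using outflow_sum_singletons[OF assms(1,2), of t h lo] outflow_all[OF assms(3,4)] assms(6)
        by (simp add: sum_subtractf)
      then have "\<forall>v\<in>V. outflow E t h lo {v} - d v = 0"
        using ge assms(2) by (subst (asm) sum_nonneg_eq_0_iff) auto
      then show ?thesis using eq by (intro exI[of _ lo]) auto
    next
      case True
      then obtain e0 where e0: "e0 \<in> E" "lo e0 < hi e0" by blast
      let ?cap = "capacity E t h lo hi"
      let ?hi = "hi(e0 := hi e0 - 1)" and ?lo = "lo(e0 := lo e0 + 1)"
      have pos: "(\<Sum>e\<in>E. hi e - lo e) > 0"
        using e0 less.prems(1) assms(1) by (intro sum_pos2[of _ e0]) auto
      have s1: "(\<Sum>e\<in>E. ?hi e - lo e) = (\<Sum>e\<in>E. hi e - lo e) - 1"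
       and s2: "(\<Sum>e\<in>E. hi e - ?lo e) = (\<Sum>e\<in>E. hi e - lo e) - 1"
        by (simp_all add: sum.remove[OF assms(1) e0(1)])
      show ?thesis
      proof (cases "\<forall>X. X \<subseteq> V \<longrightarrow> (\<Sum>v\<in>X. d v) \<le> capacity E t h lo ?hi X")
        case True
        have "\<exists>m. (\<forall>e\<in>E. lo e \<le> m e \<and> m e \<le> ?hi e) \<and> (\<forall>v\<in>V. outflow E t h m {v} = d v)"
        proof (rule less.hyps)
          show "nat (\<Sum>e\<in>E. ?hi e - lo e) < nat (\<Sum>e\<in>E. hi e - lo e)" using s1 pos by linarith
          show "lo e \<le> ?hi e" if "e \<in> E" for e using less.prems(1)[OF that] e0 by auto
          show "(\<Sum>v\<in>X. d v) \<le> capacity E t h lo ?hi X" if "X \<subseteq> V" for X using True that by blast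
        qed
        then obtain m where m: "\<forall>e\<in>E. lo e \<le> m e \<and> m e \<le> ?hi e" "\<forall>v\<in>V. outflow E t h m {v} = d v"
          by blast
        have "?hi e \<le> hi e" for e by simp
        with m show ?thesis by (meson order_trans)
      next
        case F1: False
        show ?thesis
        proof (cases "\<forall>X. X \<subseteq> V \<longrightarrow> (\<Sum>v\<in>X. d v) \<le> capacity E t h ?lo hi X")
          case True
          have "\<exists>m. (\<forall>e\<in>E. ?lo e \<le> m e \<and> m e \<le> hi e) \<and> (\<forall>v\<in>V. outflow E t h m {v} = d v)"
          proof (rule less.hyps)
            show "nat (\<Sum>e\<in>E. hi e - ?lo e) < nat (\<Sum>e\<in>E. hi e - lo e)" using s2 pos by linarith
            show "?lo e \<le> hi e" if "e \<in> E" for e using less.prems(1)[OF that] e0 by auto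
            show "(\<Sum>v\<in>X. d v) \<le> capacity E t h ?lo hi X" if "X \<subseteq> V" for X using True that by blast
          qed
          then obtain m where m: "\<forall>e\<in>E. ?lo e \<le> m e \<and> m e \<le> hi e" "\<forall>v\<in>V. outflow E t h m {v} = d v"
            by blast
          have "lo e \<le> ?lo e" for e by simp
          with m show ?thesis by (meson order_trans)
        next
          case F2: False
          obtain X where X: "X \<subseteq> V" "(\<Sum>v\<in>X. d v) > ?cap X - of_bool (t e0 \<in> X \<and> h e0 \<notin> X)"
            using F1 capacity_update(1)[OF assms(1) e0(1)] by (metis not_le)
          obtain Y where Y: "Y \<subseteq> V" "(\<Sum>v\<in>Y. d v) > ?cap Y - of_bool (t e0 \<notin> Y \<and> h e0 \<in> Y)"
            using F2 capacity_update(2)[OF assms(1) e0(1)] by (metis not_le)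
          \<comment> \<open>Lowering \<open>hi e0\<close> by 1 breaks the condition at
            \<open>X\<close>, and all values are integers; so \<open>e0\<close> leaves
            \<open>X\<close> and \<open>X\<close> was tight. Likewise \<open>e0\<close> enters the
            tight set \<open>Y\<close>.\<close>
          have X': "t e0 \<in> X" "h e0 \<notin> X" "(\<Sum>v\<in>X. d v) \<ge> ?cap X"
            using X less.prems(2)[OF X(1)] by (auto split: if_splits simp: of_bool_def)
          have Y': "t e0 \<notin> Y" "h e0 \<in> Y" "(\<Sum>v\<in>Y. d v) \<ge> ?cap Y"
            using Y less.prems(2)[OF Y(1)] by (auto split: if_splits simp: of_bool_def)
          have "?cap (X \<inter> Y) + ?cap (X \<union> Y) + (hi e0 - lo e0) \<le> ?cap X + ?cap Y"
            using less.prems(1) by (intro capacity_submodular assms e0 X' Y') auto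
          moreover have "(\<Sum>v\<in>X \<inter> Y. d v) \<le> ?cap (X \<inter> Y)" "(\<Sum>v\<in>X \<union> Y. d v) \<le> ?cap (X \<union> Y)"
            using X(1) Y(1) by (auto intro!: less.prems(2))
          moreover have "(\<Sum>v\<in>X. d v) + (\<Sum>v\<in>Y. d v) = (\<Sum>v\<in>X \<union> Y. d v) + (\<Sum>v\<in>X \<inter> Y. d v)"
            using X(1) Y(1) assms(2) by (metis finite_subset sum.union_inter)
          ultimately show ?thesis using e0(2) X'(3) Y'(3) by linarith
        qed
      qed
    qed
  qed
  then show ?thesis using that by blast
qed

text \<open>The residues of \<open>f\<close> have net outflow divisible by \<open>k\<close> at every
  vertex; subtracting \<open>k\<close> on suitable edges cancels it. These edges form an integral
  flow with capacities 0 and 1 and demand \<open>d\<close>, which exists because the residues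
  divided by \<open>k\<close> are a fractional one.\<close>

lemma lift_mod_flow:
  assumes fin: "finite E" "finite V" and ends: "t ` E \<subseteq> V" "h ` E \<subseteq> V"
    and k: "k > 0" and f: "mod_flow k E t h f"
  obtains g where "\<And>v. v \<in> V \<Longrightarrow> outflow E t h g {v} = 0"
    and "\<And>e. e \<in> E \<Longrightarrow> k dvd g e - f e \<and> \<bar>g e\<bar> < k"
proof -
  define f0 where "f0 e = f e mod k" for e
  define d where "d v = outflow E t h f0 {v} div k" for v
  \<comment> \<open>Edges with residue 0 are excluded: subtracting \<open>k\<close> there would
    violate the strict bound.\<close>
  define hi :: "'a \<Rightarrow> int" where "hi e = of_bool (f0 e \<noteq> 0)" for e
  have f0: "0 \<le> f0 e" "f0 e < k" for e using k by (simp_all add: f0_def)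
  have "k dvd f0 e - f e" for e by (simp add: f0_def mod_eq_dvd_iff[symmetric])
  then have dvd0: "k dvd outflow E t h f0 X" for X
    using outflow_dvd_diff[of E k f0 f t h X] f by (simp add: mod_flow_def dvd_diff_left_iff)
  have sum_d: "k * (\<Sum>v\<in>X. d v) = outflow E t h f0 X" if "X \<subseteq> V" for X
    using outflow_sum_singletons[OF fin(1), of X t h f0] finite_subset[OF that fin(2)] dvd0
    by (simp add: d_def sum_distrib_left)
  obtain m where m: "\<And>e. e \<in> E \<Longrightarrow> 0 \<le> m e \<and> m e \<le> hi e"
    and net: "\<And>v. v \<in> V \<Longrightarrow> outflow E t h m {v} = d v"
  proof (rule feasible_flow[OF fin ends, of "\<lambda>_. 0" hi d])
    show "(\<Sum>v\<in>V. d v) = 0" using sum_d[of V] outflow_all[OF ends] k by simp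
    fix X assume X: "X \<subseteq> V"
    have "k * (\<Sum>v\<in>X. d v) = outflow E t h f0 X" by (rule sum_d[OF X])
    also have "\<dots> \<le> k * capacity E t h (\<lambda>_. 0) hi X"
      unfolding outflow_def capacity_def sum_distrib_left
    proof (rule sum_mono)
      fix e
      show "f0 e * (of_bool (t e \<in> X) - of_bool (h e \<in> X)) \<le>
          k * (hi e * of_bool (t e \<in> X \<and> h e \<notin> X) - 0 * of_bool (t e \<notin> X \<and> h e \<in> X))"
        using f0[of e] by (auto simp: hi_def)
    qed
    finally show "(\<Sum>v\<in>X. d v) \<le> capacity E t h (\<lambda>_. 0) hi X" using k by simp
  qed (auto simp: hi_def)
  show ?thesis
  proof
    show "outflow E t h (\<lambda>e. f0 e - k * m e) {v} = 0" if "v \<in> V" for v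
      unfolding outflow_diff outflow_cmult using dvd0 net[OF that] by (simp add: d_def)
    fix e assume "e \<in> E"
    then have "m e = 0 \<or> m e = 1 \<and> f0 e \<noteq> 0"
      using m[of e] by (cases "f0 e = 0") (auto simp: hi_def)
    moreover have "k dvd (f0 e - k * m e) - f e"
      using dvd_diff[OF \<open>k dvd f0 e - f e\<close> dvd_triv_left[of k "m e"]] by (simp add: algebra_simps)
    ultimately show "k dvd (f0 e - k * m e) - f e \<and> \<bar>f0 e - k * m e\<bar> < k"
      using f0[of e] by auto
  qed
qed

section \<open>Pairs of a flow modulo 2 and a flow modulo 3\<close>

definition edges_between :: "'e set \<Rightarrow> ('e \<Rightarrow> 'v) \<Rightarrow> ('e \<Rightarrow> 'v) \<Rightarrow> 'v set \<Rightarrow> 'v set \<Rightarrow> 'e set" where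
  "edges_between E t h A B = {e \<in> E. t e \<in> A \<and> h e \<in> B \<or> t e \<in> B \<and> h e \<in> A}"

lemma card_edges_between_Un:
  assumes "finite E" "A \<inter> B = {}" "A \<inter> C = {}" "B \<inter> C = {}"
  shows "card (edges_between E t h A (B \<union> C)) = card (edges_between E t h A B) + card (edges_between E t h A C)"
proof -
  have "edges_between E t h A (B \<union> C) = edges_between E t h A B \<union> edges_between E t h A C"
    by (auto simp: edges_between_def)
  moreover have "edges_between E t h A B \<inter> edges_between E t h A C = {}"
    using assms by (auto simp: edges_between_def)
  ultimately show ?thesis
    using assms(1) by (simp add: card_Un_disjoint edges_between_def)
qed

lemma edges_between_commute: "edges_between E t h A B = edges_between E t h B A"
  by (auto simp: edges_between_def)

lemma cut_edges_eq_edges_between: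
  assumes "t ` E \<subseteq> V" "h ` E \<subseteq> V"
  shows "cut_edges E t h X = edges_between E t h X (V - X)"
  using assms by (auto simp: cut_edges_def edges_between_def)

text \<open>Choose \<open>Y\<close> smallest among the nonempty subsets of \<open>V - {r}\<close>
  joined to the rest of \<open>V - {r}\<close> by at most one edge. Its cut has at least three
  edges, so at least two of them lead to \<open>r\<close>.\<close>

lemma two_edge_connected_part:
  assumes fin: "finite E" "finite V" and ends: "t ` E \<subseteq> V" "h ` E \<subseteq> V"
    and r: "r \<in> V" "V \<noteq> {r}"
    and cuts: "\<And>X. X \<subseteq> V \<Longrightarrow> X \<noteq> {} \<Longrightarrow> X \<noteq> V \<Longrightarrow> 3 \<le> card (cut_edges E t h X)"
  obtains Y where "Y \<subseteq> V - {r}" "2 \<le> card (edges_between E t h {r} Y)"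
    and "\<And>Z. Z \<subset> Y \<Longrightarrow> Z \<noteq> {} \<Longrightarrow> 2 \<le> card (edges_between E t h Z (Y - Z))"
proof -
  let ?b = "\<lambda>A B. card (edges_between E t h A B)"
  define P where "P Y \<longleftrightarrow> Y \<noteq> {} \<and> Y \<subseteq> V - {r} \<and> ?b Y (V - {r} - Y) \<le> 1" for Y
  have "P (V - {r})" using r by (auto simp: P_def edges_between_def)
  then obtain Y where Y: "P Y" "\<And>Z. P Z \<Longrightarrow> card Y \<le> card Z"
    using ex_has_least_nat[of P _ card] by blast
  define R where "R = V - {r} - Y"
  have sub: "Y \<noteq> {}" "Y \<subseteq> V - {r}" "?b Y R \<le> 1" using Y(1) by (auto simp: P_def R_def)
  have "V - Y = {r} \<union> R" using sub r by (auto simp: R_def)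
  then have "card (cut_edges E t h Y) = ?b Y {r} + ?b Y R"
    using card_edges_between_Un[OF fin(1), of Y "{r}" R t h] sub
    by (auto simp: cut_edges_eq_edges_between[OF ends] R_def)
  moreover have "3 \<le> card (cut_edges E t h Y)"
    using sub r by (intro cuts) auto
  ultimately have "2 \<le> ?b {r} Y" using sub(3) by (simp add: edges_between_commute)
  \<comment> \<open>By minimality, \<open>Z\<close> and \<open>Y - Z\<close> each have a cut of at
    least two edges within \<open>V - {r}\<close>. Adding both counts the edges between them twice
    and at most one edge to \<open>R\<close>, so twice their number is at least 3.\<close>
  moreover have "2 \<le> ?b Z (Y - Z)" if Z: "Z \<subset> Y" "Z \<noteq> {}" for Z
  proof -
    have split: "2 \<le> ?b Z' (Y - Z') + ?b Z' R" if Z': "Z' \<subset> Y" "Z' \<noteq> {}" for Z'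
    proof -
      have "card Z' < card Y"
        using Z'(1) sub(2) fin(2) by (meson finite_Diff finite_subset psubset_card_mono)
      then have "\<not> P Z'" using Y(2) leD by blast
      then have "2 \<le> ?b Z' (V - {r} - Z')" using Z' sub(2) by (auto simp: P_def)
      moreover have "V - {r} - Z' = (Y - Z') \<union> R" using Z' sub(2) by (auto simp: R_def)
      moreover have "?b Z' ((Y - Z') \<union> R) = ?b Z' (Y - Z') + ?b Z' R"
        using Z' by (intro card_edges_between_Un fin) (auto simp: R_def)
      ultimately show ?thesis by simp
    qed
    let ?W = "Y - Z"
    have "Y - ?W = Z" "?W \<subset> Y" "?W \<noteq> {}" using Z by auto
    then have "2 \<le> ?b Z ?W + ?b ?W R" using split[of ?W] by (simp add: edges_between_commute)
    moreover have "2 \<le> ?b Z ?W + ?b Z R" using split Z by blast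
    moreover have "?b R (Z \<union> ?W) = ?b R Z + ?b R ?W"
      using Z by (intro card_edges_between_Un fin) (auto simp: R_def)
    moreover have "Z \<union> ?W = Y" using Z by auto
    ultimately show ?thesis using sub(3) by (simp add: edges_between_commute[of _ _ _ R])
  qed
  ultimately show ?thesis using that sub(2) by blast
qed

text \<open>
  The support of an integral flow of value 2 from \<open>a\<close> to \<open>b\<close> with values in \<open>{-1, 0, 1}\<close> is even,
  and its component \<open>K\<close> of \<open>a\<close> also contains \<open>b\<close>, for otherwise the flow would have no way to
  leave it. Connectivity is expressed by cuts.
\<close>

lemma connected_even_subgraph:
  assumes fin: "finite E" "finite V" and ends: "t ` E \<subseteq> V" "h ` E \<subseteq> V"
    and Y: "Y \<subseteq> V" "a \<in> Y" "b \<in> Y"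
    and two: "\<And>Z. Z \<subset> Y \<Longrightarrow> Z \<noteq> {} \<Longrightarrow> 2 \<le> card (edges_between E t h Z (Y - Z))"
  obtains C K where "C \<subseteq> E" "a \<in> K" "b \<in> K" "K \<subseteq> Y"
    and "\<And>e. e \<in> C \<Longrightarrow> t e \<in> K \<and> h e \<in> K"
    and "mod_flow 2 E t h (\<lambda>e. of_bool (e \<in> C))"
    and "\<forall>X. (\<forall>e\<in>C. t e \<in> X \<longleftrightarrow> h e \<in> X) \<longrightarrow> K \<subseteq> X \<or> K \<inter> X = {}"
proof -
  define hi :: "'a \<Rightarrow> int" where "hi e = of_bool (t e \<in> Y \<and> h e \<in> Y)" for e
  define d :: "'b \<Rightarrow> int" where "d v = 2 * of_bool (v = a) - 2 * of_bool (v = b)" for v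
  have sum_d: "(\<Sum>v\<in>X. d v) = 2 * of_bool (a \<in> X) - 2 * of_bool (b \<in> X)" if "X \<subseteq> V" for X
  proof -
    have "finite X" using that fin(2) by (rule finite_subset)
    then have "(\<Sum>v\<in>X. of_bool (v = c)) = (of_bool (c \<in> X) :: int)" for c by (simp add: of_bool_def)
    then show ?thesis by (simp add: d_def sum_subtractf flip: sum_distrib_left)
  qed
  \<comment> \<open>With bounds -1 and 1 inside \<open>Y\<close> and 0 elsewhere, capacities count
    cut edges inside \<open>Y\<close>, and \<open>two\<close> meets a demand of 2.\<close>
  have cap: "capacity E t h (\<lambda>e. - hi e) hi X = int (card (edges_between E t h (X \<inter> Y) (Y - X)))" for X
  proof -
    have "capacity E t h (\<lambda>e. - hi e) hi X =
        (\<Sum>e\<in>E. if e \<in> edges_between E t h (X \<inter> Y) (Y - X) then 1 else 0)"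
      unfolding capacity_def by (rule sum.cong) (auto simp: hi_def edges_between_def)
    also have "\<dots> = (\<Sum>e\<in>E \<inter> edges_between E t h (X \<inter> Y) (Y - X). 1)"
      using fin(1) by (simp only: sum.inter_restrict)
    also have "E \<inter> edges_between E t h (X \<inter> Y) (Y - X) = edges_between E t h (X \<inter> Y) (Y - X)"
      by (auto simp: edges_between_def)
    finally show ?thesis by simp
  qed
  obtain m where m: "\<And>e. e \<in> E \<Longrightarrow> - hi e \<le> m e \<and> m e \<le> hi e"
    and net: "\<And>v. v \<in> V \<Longrightarrow> outflow E t h m {v} = d v"
  proof (rule feasible_flow[OF fin ends, of "\<lambda>e. - hi e" hi d])
    show "(\<Sum>v\<in>V. d v) = 0" using sum_d[of V] Y by auto
    fix X assume X: "X \<subseteq> V"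
    show "(\<Sum>v\<in>X. d v) \<le> capacity E t h (\<lambda>e. - hi e) hi X"
    proof (cases "a \<in> X \<and> b \<notin> X")
      case True
      then have "X \<inter> Y \<subset> Y" "X \<inter> Y \<noteq> {}" using Y by auto
      moreover have "Y - X \<inter> Y = Y - X" by auto
      ultimately have "2 \<le> card (edges_between E t h (X \<inter> Y) (Y - X))" using two[of "X \<inter> Y"] by simp
      then show ?thesis unfolding cap sum_d[OF X] using True by simp
    next
      case False
      then show ?thesis unfolding cap sum_d[OF X] by auto
    qed
  qed (auto simp: hi_def)
  define S where "S = {e \<in> E. m e \<noteq> 0}"
  define U where "U = {X. \<forall>e\<in>S. t e \<in> X \<longleftrightarrow> h e \<in> X}"
  \<comment> \<open>The smallest set containing \<open>a\<close> that no support edge crosses, that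
    is, the component of \<open>a\<close>.\<close>
  define K where "K = \<Inter> {X \<in> U. a \<in> X}"
  define C where "C = {e \<in> S. t e \<in> K}"
  have inY: "t e \<in> Y \<and> h e \<in> Y" if "e \<in> S" for e
    using that m[of e] by (auto simp: S_def hi_def of_bool_def split: if_splits)
  have KU: "K \<in> U" by (auto simp: K_def U_def)
  have aK: "a \<in> K" by (simp add: K_def)
  have KY: "K \<subseteq> Y" using inY Y by (auto simp: K_def U_def)
  have bK: "b \<in> K"
  proof -
    have "0 = outflow E t h (\<lambda>e. 0) K" by (simp add: outflow_def)
    also have "\<dots> = outflow E t h m K"
      by (rule outflow_cong) (use KU in \<open>auto simp: U_def S_def\<close>)
    also have "\<dots> = (\<Sum>v\<in>K. outflow E t h m {v})"
      using KY Y fin by (intro outflow_sum_singletons) (auto intro: finite_subset)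
    also have "\<dots> = (\<Sum>v\<in>K. d v)" using KY Y net by (intro sum.cong) auto
    also have "\<dots> = 2 * of_bool (a \<in> K) - 2 * of_bool (b \<in> K)" using KY Y by (intro sum_d) auto
    finally show ?thesis using aK by (auto split: if_splits)
  qed
  have even: "mod_flow 2 E t h (\<lambda>e. of_bool (e \<in> C))"
  proof (rule mod_flowI[OF fin ends])
    fix v assume v: "v \<in> V"
    \<comment> \<open>The restriction of \<open>m\<close> to \<open>K\<close> has the parity of the
      indicator of \<open>C\<close>; its net outflow is \<open>d v\<close> on \<open>K\<close> and 0
      elsewhere, hence even.\<close>
    let ?m = "\<lambda>e. if t e \<in> K then m e else 0"
    have "2 dvd outflow E t h (\<lambda>e. of_bool (e \<in> C)) {v} - outflow E t h ?m {v}"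
    proof (rule outflow_dvd_diff)
      fix e assume "e \<in> E"
      then have "m e = -1 \<or> m e = 0 \<or> m e = 1" using m[of e] by (auto simp: hi_def of_bool_def split: if_splits)
      then show "2 dvd of_bool (e \<in> C) - (if t e \<in> K then m e else 0)"
        using \<open>e \<in> E\<close> by (auto simp: C_def S_def)
    qed
    moreover have "2 dvd outflow E t h ?m {v}"
    proof (cases "v \<in> K")
      case True
      then have "outflow E t h ?m {v} = outflow E t h m {v}"
        using KU by (intro outflow_cong) (auto simp: U_def S_def)
      then show ?thesis by (simp add: net[OF v] d_def)
    next
      case False
      then have "outflow E t h ?m {v} = outflow E t h (\<lambda>_. 0) {v}"
        using KU by (intro outflow_cong) (auto simp: U_def S_def)
      then show ?thesis by (simp add: outflow_def)
    qed
    ultimately show "2 dvd outflow E t h (\<lambda>e. of_bool (e \<in> C)) {v}" by (simp add: dvd_diff_right_iff)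
  qed
  \<comment> \<open>The part of \<open>K\<close> on the side of \<open>a\<close> is again crossed by
    no support edge, so minimality makes it all of \<open>K\<close>.\<close>
  have "K \<subseteq> X \<or> K \<inter> X = {}" if X: "\<forall>e\<in>C. t e \<in> X \<longleftrightarrow> h e \<in> X" for X
  proof (cases "a \<in> X")
    case True
    have "X \<inter> K \<in> U" using X KU by (auto simp: U_def C_def)
    then have "K \<subseteq> X \<inter> K" using True aK unfolding K_def by blast
    then show ?thesis by blast
  next
    case False
    have "K - X \<in> U" using X KU by (auto simp: U_def C_def)
    then have "K \<subseteq> K - X" using False aK unfolding K_def by blast
    then show ?thesis by blast
  qed
  moreover have "t e \<in> K \<and> h e \<in> K" if "e \<in> C" for e using that KU by (auto simp: C_def U_def)
  moreover have "C \<subseteq> E" by (auto simp: C_def S_def)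
  ultimately show ?thesis using aK bK KY even by (intro that[of C K]) simp_all
qed

text \<open>Let edges of \<open>C\<close> have capacity \<open>N\<close>, the sum of all absolute
  demands. One edge of \<open>C\<close> across a cut then suffices; if none crosses,
  \<open>K\<close> lies on one side and the demand of the cut is 0.\<close>

lemma connected_subgraph_flow:
  assumes fin: "finite E" "finite V" and ends: "t ` E \<subseteq> V" "h ` E \<subseteq> V"
    and K: "K \<subseteq> V" and C: "C \<subseteq> E"
    and conn: "\<forall>X. (\<forall>e\<in>C. t e \<in> X \<longleftrightarrow> h e \<in> X) \<longrightarrow> K \<subseteq> X \<or> K \<inter> X = {}"
    and d: "(\<Sum>v\<in>K. d v) = 0"
  obtains w where "\<And>e. e \<in> E \<Longrightarrow> e \<notin> C \<Longrightarrow> w e = 0"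
    and "\<And>v. v \<in> K \<Longrightarrow> outflow E t h w {v} = d v"
proof -
  define N where "N = (\<Sum>v\<in>K. \<bar>d v\<bar>)"
  define hi where "hi e = (if e \<in> C then N else 0)" for e
  define d' where "d' v = (if v \<in> K then d v else 0)" for v
  have finK: "finite K" using K fin(2) by (rule finite_subset)
  have N: "0 \<le> N" unfolding N_def by (intro sum_nonneg) auto
  have sum_d': "(\<Sum>v\<in>X. d' v) = (\<Sum>v\<in>X \<inter> K. d v)" if "X \<subseteq> V" for X
    unfolding d'_def using that fin(2) by (subst sum.inter_restrict) (auto intro: finite_subset)
  obtain w where w: "\<And>e. e \<in> E \<Longrightarrow> - hi e \<le> w e \<and> w e \<le> hi e"
    and net: "\<And>v. v \<in> V \<Longrightarrow> outflow E t h w {v} = d' v"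
  proof (rule feasible_flow[OF fin ends, of "\<lambda>e. - hi e" hi d'])
    show "(\<Sum>v\<in>V. d' v) = 0" using sum_d'[of V] d K by (simp add: inf.absorb2)
    fix X assume X: "X \<subseteq> V"
    let ?c = "\<lambda>e. hi e * of_bool (t e \<in> X \<and> h e \<notin> X) - (- hi e) * of_bool (t e \<notin> X \<and> h e \<in> X)"
    have pos: "0 \<le> ?c e" for e using N by (auto simp: hi_def)
    have cap: "capacity E t h (\<lambda>e. - hi e) hi X = sum ?c E" by (simp add: capacity_def)
    show "(\<Sum>v\<in>X. d' v) \<le> capacity E t h (\<lambda>e. - hi e) hi X"
    proof (cases "\<forall>e\<in>C. t e \<in> X \<longleftrightarrow> h e \<in> X")
      case True
      then have "K \<subseteq> X \<or> K \<inter> X = {}" using conn by blast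
      then have "X \<inter> K = K \<or> X \<inter> K = {}" by blast
      then have "(\<Sum>v\<in>X \<inter> K. d v) = 0" using d by auto
      then show ?thesis unfolding sum_d'[OF X] cap using pos by (simp add: sum_nonneg)
    next
      case False
      then obtain e where e: "e \<in> C" "\<not> (t e \<in> X \<longleftrightarrow> h e \<in> X)" by blast
      have "(\<Sum>v\<in>X \<inter> K. d v) \<le> (\<Sum>v\<in>X \<inter> K. \<bar>d v\<bar>)" by (intro sum_mono) auto
      also have "\<dots> \<le> N" unfolding N_def using finK by (intro sum_mono2) auto
      also have "N = ?c e" using e by (auto simp: hi_def)
      also have "?c e \<le> sum ?c E" using e(1) C fin(1) pos by (intro member_le_sum) auto
      finally show ?thesis unfolding sum_d'[OF X] cap .
    qed
  qed (use N in \<open>auto simp: hi_def\<close>)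
  show ?thesis
  proof
    show "w e = 0" if "e \<in> E" "e \<notin> C" for e using w[OF that(1)] that(2) by (simp add: hi_def)
    show "outflow E t h w {v} = d v" if "v \<in> K" for v using net that K by (auto simp: d'_def)
  qed
qed

text \<open>A set that does not split \<open>S\<close> is its own preimage under the contraction,
  and edges inside \<open>S\<close>, where \<open>g\<close> is arbitrary, do not cross it.\<close>

lemma mod_flow_contract_dvd:
  assumes "mod_flow k E (\<pi> \<circ> t) (\<pi> \<circ> h) f" "\<pi> = (\<lambda>v. if v \<in> S then r else v)" "r \<in> S"
    and "\<And>e. e \<in> E \<Longrightarrow> \<not> (t e \<in> S \<and> h e \<in> S) \<Longrightarrow> g e = f e"
    and "S \<subseteq> X \<or> S \<inter> X = {}"
  shows "k dvd outflow E t h g X"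
proof -
  have "outflow E t h g X = outflow E t h f X"
    using assms(4,5) by (intro outflow_cong) auto
  also have "X = \<pi> -` X" using assms(2,3,5) by (auto split: if_splits)
  then have "outflow E t h f X = outflow E (\<pi> \<circ> t) (\<pi> \<circ> h) f X" by (simp add: outflow_comp)
  finally show ?thesis using assms(1) by (simp add: mod_flow_def)
qed

text \<open>Vertices outside \<open>S\<close>, and \<open>S\<close> as a whole, inherit divisibility
  from the contracted graph; with \<open>inner\<close>, the vertex \<open>r\<close> follows by
  difference.\<close>

lemma mod_flow_uncontract:
  assumes fin: "finite E" "finite V" and ends: "t ` E \<subseteq> V" "h ` E \<subseteq> V"
    and contr: "mod_flow k E (\<pi> \<circ> t) (\<pi> \<circ> h) f" "\<pi> = (\<lambda>v. if v \<in> S then r else v)" "r \<in> S" "S \<subseteq> V"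
    and g: "\<And>e. e \<in> E \<Longrightarrow> \<not> (t e \<in> S \<and> h e \<in> S) \<Longrightarrow> g e = f e"
    and inner: "\<And>v. v \<in> S - {r} \<Longrightarrow> k dvd outflow E t h g {v}"
  shows "mod_flow k E t h g"
proof (rule mod_flowI[OF fin ends])
  fix v assume v: "v \<in> V"
  note dvd = mod_flow_contract_dvd[OF contr(1-3) g]
  have finS: "finite S" using contr(4) fin(2) by (rule finite_subset)
  consider "v \<notin> S" | "v \<in> S - {r}" | "v = r" by blast
  then show "k dvd outflow E t h g {v}"
  proof cases
    case 1
    then show ?thesis by (intro dvd) auto
  next
    case 2
    then show ?thesis by (rule inner)
  next
    case 3
    have "outflow E t h g S = outflow E t h g (S - {r}) + outflow E t h g {r}"
      using outflow_Un[OF fin(1), of "S - {r}" "{r}" t h g] contr(3) by (simp add: insert_absorb)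
    moreover have "k dvd outflow E t h g S" by (intro dvd) auto
    moreover have "k dvd outflow E t h g (S - {r})"
      using outflow_sum_singletons[OF fin(1), of "S - {r}" t h g] finS inner by (auto intro: dvd_sum)
    ultimately show ?thesis using 3 by (simp add: dvd_add_right_iff)
  qed
qed

lemma ex_signs_dvd_3:
  fixes c s1 s2 :: int
  assumes "s1 \<in> {-1, 1}" "s2 \<in> {-1, 1}"
  obtains y1 y2 where "y1 \<in> {-1, 1}" "y2 \<in> {-1, 1}" "3 dvd c + s1 * y1 + s2 * y2"
proof -
  have c: "c mod 3 = 0 \<or> c mod 3 = 1 \<or> c mod 3 = 2" by presburger
  have "\<exists>z1 z2. z1 \<in> {-1, 1} \<and> z2 \<in> {-1, 1::int} \<and> 3 dvd c + z1 + z2"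
    using c
  proof (elim disjE)
    assume "c mod 3 = 0"
    then have "3 dvd c + 1 + (-1)" by presburger
    then show ?thesis by blast
  next
    assume "c mod 3 = 1"
    then have "3 dvd c + 1 + 1" by presburger
    then show ?thesis by blast
  next
    assume "c mod 3 = 2"
    then have "3 dvd c + (-1) + (-1)" by presburger
    then show ?thesis by blast
  qed
  then obtain z1 z2 where "z1 \<in> {-1, 1}" "z2 \<in> {-1, 1}" "3 dvd c + z1 + z2" by blast
  then show ?thesis using assms that[of "s1 * z1" "s2 * z2"] by auto
qed

section \<open>The 3-edge-connected case\<close>

text \<open>
  Requiring the mod 2 flow to vanish at the root \<open>r\<close> makes the induction work: when a connected
  even subgraph \<open>C\<close> joined to \<open>r\<close> by at least two edges is contracted into \<open>r\<close>, the mod 2 flow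
  extends by 1 on \<open>C\<close>, which frees the mod 3 flow on \<open>C\<close>. The values of the latter on the edges
  between \<open>r\<close> and \<open>C\<close> can be chosen non-zero because any residue is a sum of two non-zero
  residues modulo 3.
\<close>

theorem three_edge_connected_flow_pair:
  assumes "finite E" "finite V" "t ` E \<subseteq> V" "h ` E \<subseteq> V" "r \<in> V"
    and "\<And>X. X \<subseteq> V \<Longrightarrow> X \<noteq> {} \<Longrightarrow> X \<noteq> V \<Longrightarrow> 3 \<le> card (cut_edges E t h X)"
  shows "\<exists>\<phi> \<psi>. mod_flow 2 E t h \<phi> \<and> mod_flow 3 E t h \<psi> \<and>
    (\<forall>e\<in>E. odd (\<phi> e) \<or> \<not> 3 dvd \<psi> e) \<and> (\<forall>e\<in>E. t e = r \<or> h e = r \<longrightarrow> \<phi> e = 0)"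
  using assms(2-6)
proof (induction "card V" arbitrary: V t h rule: less_induct)
  case less
  note fin = \<open>finite E\<close> less.prems(1) and ends = less.prems(2,3) and r = less.prems(4)
  show ?case
  proof (cases "V = {r}")
    case True
    \<comment> \<open>All edges are loops at \<open>r\<close>, so every function is a flow.\<close>
    have "mod_flow k E t h f" for k f
      using outflow_all[OF ends] True by (intro mod_flowI[OF fin ends]) auto
    then show ?thesis by (intro exI[of _ "\<lambda>_. 0"] exI[of _ "\<lambda>_. 1"]) auto
  next
    case False
    obtain Y where Y: "Y \<subseteq> V - {r}" "2 \<le> card (edges_between E t h {r} Y)"
      and Y2: "\<And>Z. Z \<subset> Y \<Longrightarrow> Z \<noteq> {} \<Longrightarrow> 2 \<le> card (edges_between E t h Z (Y - Z))"
      using two_edge_connected_part[OF fin ends r False less.prems(5)] by blast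
    obtain e1 e2 where e12: "e1 \<in> edges_between E t h {r} Y" "e2 \<in> edges_between E t h {r} Y" "e1 \<noteq> e2"
    proof -
      have "finite (edges_between E t h {r} Y)" using fin(1) by (simp add: edges_between_def)
      moreover have "\<not> card (edges_between E t h {r} Y) \<le> Suc 0" using Y(2) by simp
      ultimately show ?thesis using that by (auto simp: card_le_Suc0_iff_eq)
    qed
    obtain a where a: "a \<in> Y" "t e1 = r \<and> h e1 = a \<or> t e1 = a \<and> h e1 = r"
      using e12(1) by (auto simp: edges_between_def)
    obtain b where b: "b \<in> Y" "t e2 = r \<and> h e2 = b \<or> t e2 = b \<and> h e2 = r"
      using e12(2) by (auto simp: edges_between_def)
    have e12E: "e1 \<in> E" "e2 \<in> E" using e12 by (auto simp: edges_between_def)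
    have YV: "Y \<subseteq> V" using Y(1) by blast
    obtain C K where C: "C \<subseteq> E" and K: "a \<in> K" "b \<in> K" "K \<subseteq> Y"
      and CK: "\<And>e. e \<in> C \<Longrightarrow> t e \<in> K \<and> h e \<in> K"
      and even: "mod_flow 2 E t h (\<lambda>e. of_bool (e \<in> C))"
      and conn: "\<forall>X. (\<forall>e\<in>C. t e \<in> X \<longleftrightarrow> h e \<in> X) \<longrightarrow> K \<subseteq> X \<or> K \<inter> X = {}"
      by (rule connected_even_subgraph[OF fin ends YV a(1) b(1) Y2]) blast+
    have rK: "r \<notin> K" and KV: "K \<subseteq> V" using K(3) Y(1) by auto
    have finK: "finite K" using KV fin(2) by (rule finite_subset)
    define S where "S = insert r K"
    define \<pi> where "\<pi> = (\<lambda>v. if v \<in> S then r else v)"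
    let ?V = "\<pi> ` V"
    have V': "?V \<subseteq> V - {a}" using r rK K(1) by (auto simp: \<pi>_def S_def)
    have "\<exists>\<phi> \<psi>. mod_flow 2 E (\<pi> \<circ> t) (\<pi> \<circ> h) \<phi> \<and> mod_flow 3 E (\<pi> \<circ> t) (\<pi> \<circ> h) \<psi> \<and>
      (\<forall>e\<in>E. odd (\<phi> e) \<or> \<not> 3 dvd \<psi> e) \<and>
      (\<forall>e\<in>E. (\<pi> \<circ> t) e = r \<or> (\<pi> \<circ> h) e = r \<longrightarrow> \<phi> e = 0)"
    proof (rule less.hyps)
      show "card ?V < card V"
        using V' K(1) KV by (intro psubset_card_mono[OF fin(2)]) blast
      show "r \<in> ?V" using r by (auto simp: \<pi>_def image_iff intro!: bexI[of _ r])
      show "(\<pi> \<circ> t) ` E \<subseteq> ?V" "(\<pi> \<circ> h) ` E \<subseteq> ?V" "finite ?V" using ends fin by auto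
      fix X assume X: "X \<subseteq> ?V" "X \<noteq> {}" "X \<noteq> ?V"
      have "\<pi> -` X \<inter> V \<noteq> {}" "\<pi> -` X \<inter> V \<noteq> V" using X by blast+
      then have "3 \<le> card (cut_edges E t h (\<pi> -` X \<inter> V))" by (intro less.prems(5)) auto
      then show "3 \<le> card (cut_edges E (\<pi> \<circ> t) (\<pi> \<circ> h) X)"
        by (simp only: cut_edges_Int[OF ends] cut_edges_comp)
    qed
    then obtain \<phi>' \<psi>' where \<phi>': "mod_flow 2 E (\<pi> \<circ> t) (\<pi> \<circ> h) \<phi>'"
      and \<psi>': "mod_flow 3 E (\<pi> \<circ> t) (\<pi> \<circ> h) \<psi>'"
      and cover': "\<forall>e\<in>E. odd (\<phi>' e) \<or> \<not> 3 dvd \<psi>' e"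
      and root': "\<forall>e\<in>E. (\<pi> \<circ> t) e = r \<or> (\<pi> \<circ> h) e = r \<longrightarrow> \<phi>' e = 0"
      by blast
    have S: "r \<in> S" "S \<subseteq> V" "S - {r} = K" using r KV rK by (auto simp: S_def)
    have inS: "t e \<in> S \<and> h e \<in> S" if "e \<in> C" for e using CK[OF that] by (simp add: S_def)
    have rC: "e \<notin> C" if "t e = r \<or> h e = r" for e using CK rK that by blast
    define \<phi> where "\<phi> e = (if e \<in> C then 1 else \<phi>' e)" for e
    have \<phi>_flow: "mod_flow 2 E t h \<phi>"
    proof (rule mod_flow_uncontract[OF fin ends \<phi>' \<pi>_def S(1,2)])
      show "\<phi> e = \<phi>' e" if "\<not> (t e \<in> S \<and> h e \<in> S)" for e using inS that by (auto simp: \<phi>_def)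
      fix v assume "v \<in> S - {r}"
      \<comment> \<open>Contraction moves every edge at \<open>v\<close> to \<open>r\<close>, where
        \<open>\<phi>'\<close> vanishes; only \<open>C\<close> contributes at
        \<open>v\<close>.\<close>
      then have "outflow E t h \<phi> {v} = outflow E t h (\<lambda>e. of_bool (e \<in> C)) {v}"
        using root' by (intro outflow_cong) (auto simp: \<phi>_def \<pi>_def)
      then show "2 dvd outflow E t h \<phi> {v}" using even by (simp add: mod_flow_def)
    qed
    \<comment> \<open>Edges inside \<open>S\<close> become loops under contraction, so their values
      are free and start at 1. Changing them to \<open>y1\<close> and \<open>y2\<close> on
      \<open>e1\<close> and \<open>e2\<close> alters the net outflow of \<open>K\<close> by
      \<open>s1 * (y1 - 1) + s2 * (y2 - 1)\<close>, which makes it divisible by 3.\<close>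
    define \<psi>1 where "\<psi>1 e = (if t e \<in> S \<and> h e \<in> S then 1 else \<psi>' e)" for e
    define s1 s2 :: int where "s1 = of_bool (t e1 \<in> K) - of_bool (h e1 \<in> K)"
      and "s2 = of_bool (t e2 \<in> K) - of_bool (h e2 \<in> K)"
    have "s1 \<in> {-1, 1}" "s2 \<in> {-1, 1}" using a b K rK by (auto simp: s1_def s2_def)
    then obtain y1 y2 where y: "y1 \<in> {-1, 1}" "y2 \<in> {-1, 1}"
      and dvd: "3 dvd outflow E t h \<psi>1 K - s1 - s2 + s1 * y1 + s2 * y2"
      using ex_signs_dvd_3 by blast
    define \<psi>2 where "\<psi>2 e = \<psi>1 e + (if e = e1 then y1 - 1 else 0) + (if e = e2 then y2 - 1 else 0)" for e
    have "outflow E t h \<psi>2 K = outflow E t h \<psi>1 K - s1 - s2 + s1 * y1 + s2 * y2"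
      unfolding \<psi>2_def outflow_add outflow_single[OF fin(1) e12E(1)] outflow_single[OF fin(1) e12E(2)]
      by (simp add: s1_def s2_def algebra_simps)
    then obtain q where q: "outflow E t h \<psi>2 K = 3 * q" using dvd by (auto elim: dvdE)
    \<comment> \<open>A correction supported on \<open>C\<close> gathers the whole net outflow
      \<open>3 * q\<close> of \<open>K\<close> at \<open>a\<close> and leaves 0 at its other
      vertices.\<close>
    obtain w where w: "\<And>e. e \<in> E \<Longrightarrow> e \<notin> C \<Longrightarrow> w e = 0"
      and net_w: "\<And>v. v \<in> K \<Longrightarrow> outflow E t h w {v} = (if v = a then 3 * q else 0) - outflow E t h \<psi>2 {v}"
    proof (rule connected_subgraph_flow[OF fin ends KV C conn])
      show "(\<Sum>v\<in>K. (if v = a then 3 * q else 0) - outflow E t h \<psi>2 {v}) = 0"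
        using outflow_sum_singletons[OF fin(1) finK, of t h \<psi>2] q finK K(1) by (simp add: sum_subtractf)
    qed blast
    define \<psi> where "\<psi> e = \<psi>2 e + w e" for e
    have e12S: "t e1 \<in> S \<and> h e1 \<in> S" "t e2 \<in> S \<and> h e2 \<in> S" using a b K by (auto simp: S_def)
    have outside: "\<psi> e = \<psi>' e" if "e \<in> E" "\<not> (t e \<in> S \<and> h e \<in> S)" for e
    proof -
      have "e \<noteq> e1" "e \<noteq> e2" "e \<notin> C" using that(2) e12S inS by auto
      then show ?thesis using that w by (auto simp: \<psi>_def \<psi>2_def \<psi>1_def)
    qed
    have \<psi>_flow: "mod_flow 3 E t h \<psi>"
    proof (rule mod_flow_uncontract[OF fin ends \<psi>' \<pi>_def S(1,2) outside])
      fix v assume "v \<in> S - {r}"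
      then have "v \<in> K" using S(3) by simp
      then show "3 dvd outflow E t h \<psi> {v}"
        unfolding \<psi>_def outflow_add by (simp add: net_w)
    qed
    have "odd (\<phi> e) \<or> \<not> 3 dvd \<psi> e" if e: "e \<in> E" for e
    proof (cases "e \<in> C")
      case False
      show ?thesis
      proof (cases "t e \<in> S \<and> h e \<in> S")
        case True
        then have "\<psi> e \<in> {1, y1, y2}"
          using w[OF e False] e12(3) by (auto simp: \<psi>_def \<psi>2_def \<psi>1_def)
        then show ?thesis using y by auto
      next
        case False
        then show ?thesis using outside[OF e] cover' e \<open>e \<notin> C\<close> by (simp add: \<phi>_def)
      qed
    qed (simp add: \<phi>_def)
    moreover have "\<phi> e = 0" if "e \<in> E" "t e = r \<or> h e = r" for e
      using root' rC[OF that(2)] that S(1) by (auto simp: \<phi>_def \<pi>_def)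
    ultimately show ?thesis using \<phi>_flow \<psi>_flow by blast
  qed
qed

section \<open>Reduction of bridgeless graphs to the 3-edge-connected case\<close>

text \<open>
  Across a cut of size 0 or 2, an end on either side are identified; the values of the flow on the
  two cut edges agree up to sign, so that the pair stays non-zero on both.
\<close>

theorem bridgeless_flow_pair:
  assumes "finite E" "finite V" "t ` E \<subseteq> V" "h ` E \<subseteq> V"
    and "\<And>X. card (cut_edges E t h X) \<noteq> 1"
  shows "\<exists>\<phi> \<psi>. mod_flow 2 E t h \<phi> \<and> mod_flow 3 E t h \<psi> \<and> (\<forall>e\<in>E. odd (\<phi> e) \<or> \<not> 3 dvd \<psi> e)"
  using assms(2-5)
proof (induction "card V" arbitrary: V t h rule: less_induct)
  case less
  note fin = \<open>finite E\<close> less.prems(1) and ends = less.prems(2,3)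
  consider "V = {}" | "V \<noteq> {}" "\<And>X. X \<subseteq> V \<Longrightarrow> X \<noteq> {} \<Longrightarrow> X \<noteq> V \<Longrightarrow> 3 \<le> card (cut_edges E t h X)"
    | X where "X \<subseteq> V" "X \<noteq> {}" "X \<noteq> V" "card (cut_edges E t h X) < 3"
    by (meson not_le)
  then show ?case
  proof cases
    case 1
    then have "E = {}" using ends by auto
    then show ?thesis by (auto simp: mod_flow_def outflow_def)
  next
    case 2
    then obtain r where "r \<in> V" by blast
    then show ?thesis using three_edge_connected_flow_pair[OF fin ends _ 2(2)] by blast
  next
    case 3
    have finc: "finite (cut_edges E t h X)" using fin(1) by (simp add: cut_edges_def)
    have "card (cut_edges E t h X) = 0 \<or> card (cut_edges E t h X) = 2"
      using 3(4) less.prems(4)[of X] by linarith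
    \<comment> \<open>The lifted flow is \<open>\<sigma> e * f (u e)\<close>. In a cut of two edges,
      one of them, with ends \<open>x\<close> and \<open>y\<close>, copies the other up to sign; in
      an empty cut nothing changes. Either way the net outflow of \<open>X\<close> is exactly
      0.\<close>
    then obtain x y \<sigma> u where xy: "x \<in> X" "y \<in> V - X"
      and u: "\<And>e. e \<in> E \<Longrightarrow> u e \<in> E" "\<And>e. \<sigma> e \<in> {-1, 1::int}"
      and same: "\<And>e. e \<in> E \<Longrightarrow> \<not> (t e \<in> {y, x} \<and> h e \<in> {y, x}) \<Longrightarrow> u e = e \<and> \<sigma> e = 1"
      and zero: "\<And>f. outflow E t h (\<lambda>e. \<sigma> e * f (u e)) X = 0"
    proof (elim disjE)
      assume "card (cut_edges E t h X) = 0"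
      then have empty: "cut_edges E t h X = {}" using finc by simp
      obtain x y where "x \<in> X" "y \<in> V - X" using 3 by blast
      moreover have "outflow E t h f X = 0" for f
        unfolding outflow_def using empty by (intro sum.neutral) (auto simp: cut_edges_def)
      ultimately show ?thesis using that[of x y "\<lambda>e. e" "\<lambda>_. 1"] by simp
    next
      assume "card (cut_edges E t h X) = 2"
      then obtain e0 f0 where ef: "cut_edges E t h X = {e0, f0}" "e0 \<noteq> f0"
        by (auto simp: card_2_iff)
      have efE: "e0 \<in> E" "f0 \<in> E" using ef by (auto simp: cut_edges_def)
      have "e0 \<in> cut_edges E t h X" using ef by simp
      then obtain x y where xy: "x \<in> X" "y \<in> V - X" "{t e0, h e0} = {x, y}"
        using ends efE by (auto simp: cut_edges_def)
      define s where "s e = (of_bool (t e \<in> X) - of_bool (h e \<in> X) :: int)" for e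
      have s: "s e0 \<in> {-1, 1}" "s f0 \<in> {-1, 1}" using ef(1) by (auto simp: s_def cut_edges_def)
      have out: "outflow E t h f X = s e0 * f e0 + s f0 * f f0" for f
      proof -
        have "outflow E t h f X = (\<Sum>e\<in>{e0, f0}. f e * s e)"
          unfolding outflow_def s_def using fin(1) efE ef(1)
          by (intro sum.mono_neutral_right) (auto simp: cut_edges_def)
        then show ?thesis using ef(2) by (simp add: mult.commute)
      qed
      show ?thesis
      proof (rule that[of x y "\<lambda>e. if e = e0 then f0 else e" "\<lambda>e. if e = e0 then - (s e0 * s f0) else 1"])
        show "outflow E t h (\<lambda>e. (if e = e0 then - (s e0 * s f0) else 1) * f (if e = e0 then f0 else e)) X = 0" for f
          unfolding out using s ef(2) by auto
      qed (use xy efE s in \<open>auto simp: doubleton_eq_iff\<close>)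
    qed
    let ?S = "{y, x}"
    define \<pi> where "\<pi> = (\<lambda>v. if v \<in> ?S then y else v)"
    let ?V = "\<pi> ` V"
    have S: "y \<in> ?S" "?S \<subseteq> V" "x \<noteq> y" using xy 3(1) by auto
    have "?V \<subseteq> V - {x}" using S by (auto simp: \<pi>_def)
    then have card: "card ?V < card V" using fin(2) S(2) by (intro psubset_card_mono) auto
    have "\<exists>\<phi> \<psi>. mod_flow 2 E (\<pi> \<circ> t) (\<pi> \<circ> h) \<phi> \<and> mod_flow 3 E (\<pi> \<circ> t) (\<pi> \<circ> h) \<psi> \<and>
      (\<forall>e\<in>E. odd (\<phi> e) \<or> \<not> 3 dvd \<psi> e)"
    proof (rule less.hyps[OF card])
      show "(\<pi> \<circ> t) ` E \<subseteq> ?V" "(\<pi> \<circ> h) ` E \<subseteq> ?V" "finite ?V" using ends fin by auto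
      show "card (cut_edges E (\<pi> \<circ> t) (\<pi> \<circ> h) Z) \<noteq> 1" for Z
        unfolding cut_edges_comp by (rule less.prems(4))
    qed
    then obtain \<phi> \<psi> where \<phi>: "mod_flow 2 E (\<pi> \<circ> t) (\<pi> \<circ> h) \<phi>"
      and \<psi>: "mod_flow 3 E (\<pi> \<circ> t) (\<pi> \<circ> h) \<psi>" and cover: "\<forall>e\<in>E. odd (\<phi> e) \<or> \<not> 3 dvd \<psi> e"
      by blast
    have lift: "mod_flow k E t h (\<lambda>e. \<sigma> e * f (u e))" if f: "mod_flow k E (\<pi> \<circ> t) (\<pi> \<circ> h) f" for k f
    proof (rule mod_flow_uncontract[OF fin ends f \<pi>_def S(1,2)])
      show eq: "\<sigma> e * f (u e) = f e" if "e \<in> E" "\<not> (t e \<in> ?S \<and> h e \<in> ?S)" for e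
        using same[OF that] by simp
      fix v assume "v \<in> ?S - {y}"
      then have v: "v = x" by simp
      \<comment> \<open>\<open>X - {x}\<close> misses both identified vertices, so its net outflow
        is divisible by \<open>k\<close>; that of \<open>X\<close> is 0, which settles
        \<open>x\<close>.\<close>
      have "k dvd outflow E t h (\<lambda>e. \<sigma> e * f (u e)) (X - {x})"
        using xy by (intro mod_flow_contract_dvd[OF f \<pi>_def S(1) eq]) auto
      moreover have "outflow E t h (\<lambda>e. \<sigma> e * f (u e)) X =
          outflow E t h (\<lambda>e. \<sigma> e * f (u e)) (X - {x}) + outflow E t h (\<lambda>e. \<sigma> e * f (u e)) {x}"
        using outflow_Un[OF fin(1), of "X - {x}" "{x}" t h] xy(1) by (simp add: insert_absorb)
      ultimately show "k dvd outflow E t h (\<lambda>e. \<sigma> e * f (u e)) {v}"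
        unfolding v zero by (metis dvd_0_right dvd_add_right_iff)
    qed
    have "odd (\<sigma> e * \<phi> (u e)) \<or> \<not> 3 dvd \<sigma> e * \<psi> (u e)" if "e \<in> E" for e
      using cover u(1)[OF that] u(2)[of e] by auto
    then show ?thesis using lift[OF \<phi>] lift[OF \<psi>] by blast
  qed
qed

section \<open>From modular pairs to integral flows\<close>

text \<open>
  Lifting the mod 3 flow gives an integral flow \<open>g\<close> with values of modulus at most 2; its odd part
  lifts to a flow \<open>s\<close> with values in \<open>{-1, 0, 1}\<close>, and \<open>p\<close>, \<open>q\<close> are half the sum and half the
  difference of \<open>g\<close> and \<open>s\<close>.
\<close>

theorem bridgeless_integral_flows:
  assumes fin: "finite E" "finite V" and ends: "t ` E \<subseteq> V" "h ` E \<subseteq> V"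
    and "\<And>X. card (cut_edges E t h X) \<noteq> 1"
  obtains a p q where "\<And>v. v \<in> V \<Longrightarrow> outflow E t h a {v} = 0"
    and "\<And>v. v \<in> V \<Longrightarrow> outflow E t h p {v} = 0" and "\<And>v. v \<in> V \<Longrightarrow> outflow E t h q {v} = 0"
    and "\<And>e. e \<in> E \<Longrightarrow> \<bar>a e\<bar> \<le> 1 \<and> \<bar>p e\<bar> \<le> 1 \<and> \<bar>q e\<bar> \<le> 1 \<and> \<bar>p e - q e\<bar> \<le> 1"
    and "\<And>e. e \<in> E \<Longrightarrow> \<not> (a e = 0 \<and> p e = 0 \<and> q e = 0)"
proof -
  obtain \<phi> \<psi> where \<phi>: "mod_flow 2 E t h \<phi>" and \<psi>: "mod_flow 3 E t h \<psi>"
    and cover: "\<forall>e\<in>E. odd (\<phi> e) \<or> \<not> 3 dvd \<psi> e"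
    using bridgeless_flow_pair[OF assms] by blast
  obtain a where a: "\<And>v. v \<in> V \<Longrightarrow> outflow E t h a {v} = 0"
      "\<And>e. e \<in> E \<Longrightarrow> 2 dvd a e - \<phi> e \<and> \<bar>a e\<bar> < 2"
    using lift_mod_flow[OF fin ends _ \<phi>] by (metis zero_less_numeral)
  obtain g where g: "\<And>v. v \<in> V \<Longrightarrow> outflow E t h g {v} = 0"
      "\<And>e. e \<in> E \<Longrightarrow> 3 dvd g e - \<psi> e \<and> \<bar>g e\<bar> < 3"
    using lift_mod_flow[OF fin ends _ \<psi>] by (metis zero_less_numeral)
  have "mod_flow 2 E t h g" by (rule mod_flowI[OF fin ends]) (simp add: g(1))
  then obtain s where s: "\<And>v. v \<in> V \<Longrightarrow> outflow E t h s {v} = 0"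
      "\<And>e. e \<in> E \<Longrightarrow> 2 dvd s e - g e \<and> \<bar>s e\<bar> < 2"
    using lift_mod_flow[OF fin ends] by (metis zero_less_numeral)
  define p q where "p e = (g e + s e) div 2" and "q e = (g e - s e) div 2" for e
  have pq: "2 * p e = g e + s e" "2 * q e = g e - s e" if "e \<in> E" for e
    using s(2)[OF that] unfolding p_def q_def by presburger+
  have "2 * outflow E t h p X = outflow E t h g X + outflow E t h s X" for X
    unfolding outflow_cmult[symmetric] outflow_add[symmetric] by (rule outflow_cong) (rule pq)
  moreover have "2 * outflow E t h q X = outflow E t h g X - outflow E t h s X" for X
    unfolding outflow_cmult[symmetric] outflow_diff[symmetric] by (rule outflow_cong) (rule pq)
  ultimately have flows: "outflow E t h p {v} = 0" "outflow E t h q {v} = 0" if "v \<in> V" for v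
    using g(1)[OF that] s(1)[OF that] by (metis add_0 diff_0_right mult_eq_0_iff zero_neq_numeral)+
  \<comment> \<open>\<open>p - q\<close> is \<open>s\<close>, and
    \<open>2 * \<bar>p e\<bar> \<le> 2 + 1\<close> forces \<open>\<bar>p e\<bar> \<le> 1\<close>;
    likewise for \<open>q\<close>.\<close>
  have "\<bar>a e\<bar> \<le> 1 \<and> \<bar>p e\<bar> \<le> 1 \<and> \<bar>q e\<bar> \<le> 1 \<and> \<bar>p e - q e\<bar> \<le> 1" if "e \<in> E" for e
    using a(2)[OF that] g(2)[OF that] s(2)[OF that] pq[OF that] by linarith
  \<comment> \<open>If \<open>p e\<close> and \<open>q e\<close> are 0, so is \<open>g e\<close>,
    whence \<open>3 dvd \<psi> e\<close>; and \<open>a e = 0\<close> makes \<open>\<phi> e\<close>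
    even.\<close>
  moreover have "\<not> (a e = 0 \<and> p e = 0 \<and> q e = 0)" if "e \<in> E" for e
    using a(2)[OF that] g(2)[OF that] pq[OF that] cover that by auto
  ultimately show ?thesis using that[of a p q] a(1) flows by blast
qed

section \<open>Vector flows of bridgeless graphs\<close>

lemma equiv_connection:
  assumes "multigraph G"
  shows "equiv (vertices G) (connection G)"
proof (rule equivI)
  have "sym (adjacent G)" by (auto simp: adjacent_def sym_def insert_commute)
  then show "sym (connection G)"
    unfolding connection_def by (intro sym_Int sym_rtrancl) (auto simp: sym_def)
  show "trans (connection G)"
    unfolding connection_def by (intro trans_Int trans_rtrancl) (auto simp: trans_def)
qed (auto simp: connection_def refl_on_def)

text \<open>If \<open>e\<close> is the only edge across \<open>X\<close>, no path avoiding
  \<open>e\<close> crosses \<open>X\<close>, so deleting \<open>e\<close> separates its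
  ends.\<close>

lemma bridgeless_cut_edges:
  assumes G: "multigraph G" "bridgeless G"
    and ends: "\<And>e. e \<in> edges G \<Longrightarrow> ends G e = {t e, h e}"
  shows "card (cut_edges (edges G) t h X) \<noteq> 1"
proof
  assume "card (cut_edges (edges G) t h X) = 1"
  then obtain e where e: "cut_edges (edges G) t h X = {e}" by (auto simp: card_1_singleton_iff)
  then have eG: "e \<in> edges G" and cross: "t e \<in> X \<longleftrightarrow> h e \<notin> X" by (auto simp: cut_edges_def)
  let ?G' = "delete_edge G e"
  have G': "multigraph ?G'" using G(1) by (simp add: multigraph_def delete_edge_def)
  let ?V = "vertices G" and ?R = "connection G" and ?R' = "connection ?G'"
  have V': "vertices ?G' = ?V" by (simp add: delete_edge_def)
  have R: "equiv ?V ?R" and R': "equiv ?V ?R'"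
    using equiv_connection[OF G(1)] equiv_connection[OF G'] V' by auto
  have finV: "finite ?V" using G(1) by (simp add: multigraph_def)
  have teV: "t e \<in> ?V" "h e \<in> ?V" using G(1) eG ends[OF eG] by (auto simp: multigraph_def)
  have "adjacent ?G' \<subseteq> adjacent G" by (auto simp: adjacent_def delete_edge_def)
  then have sub: "?R' \<subseteq> ?R" unfolding connection_def V' by (auto dest: rtrancl_mono)
  have te: "(t e, h e) \<in> ?R"
    using teV eG ends[OF eG] by (auto simp: connection_def adjacent_def)
  have "u \<in> X \<longleftrightarrow> v \<in> X" if "(u, v) \<in> (adjacent ?G')\<^sup>*" for u v
    using that
  proof (induction rule: rtrancl_induct)
    case (step v w)
    then obtain e' where e': "e' \<in> edges G" "e' \<noteq> e" "{t e', h e'} = {v, w}"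
      using ends by (auto simp: adjacent_def delete_edge_def)
    then have "e' \<notin> cut_edges (edges G) t h X" using e by blast
    then have "v \<in> X \<longleftrightarrow> w \<in> X" using e'(1,3) by (auto simp: cut_edges_def doubleton_eq_iff)
    then show ?case using step.IH by simp
  qed simp
  then have sep: "(t e, h e) \<notin> ?R'" using cross by (auto simp: connection_def)
  \<comment> \<open>Sends a component of the graph without \<open>e\<close> to the component of
    \<open>G\<close> containing it. This is onto but identifies the components of the two ends, so
    deletion increases the count.\<close>
  let ?f = "\<lambda>A. ?R `` A"
  have f: "?f (?R' `` {v}) = ?R `` {v}" if "v \<in> ?V" for v
    using that sub R R' by (auto simp: equiv_def refl_on_def dest: transD)
  have img: "?f ` (?V // ?R') = ?V // ?R"
    using f by (auto simp: quotient_def image_iff)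
  have fin: "finite (?V // ?R')"
    using finV by (auto simp: quotient_def)
  have "card (?V // ?R) \<le> card (?V // ?R')" using card_image_le[OF fin, of ?f] img by simp
  moreover have "card (?V // ?R) \<noteq> card (?V // ?R')"
  proof
    assume "card (?V // ?R) = card (?V // ?R')"
    then have "inj_on ?f (?V // ?R')" using img fin by (metis eq_card_imp_inj_on)
    moreover have "?f (?R' `` {t e}) = ?f (?R' `` {h e})"
      using f teV te R by (simp add: equiv_class_eq)
    ultimately have "?R' `` {t e} = ?R' `` {h e}"
      by (rule inj_onD) (intro quotientI teV)+
    then show False using sep teV R' by (metis eq_equiv_class)
  qed
  ultimately have "is_bridge G e" using eG by (simp add: is_bridge_def mgraph_components_def V')
  then show False using G(2) eG by (simp add: bridgeless_def)
qed

lemma p_norm_zero: "p_norm p (0 :: real ^ 'd) = 0"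
  by (simp add: p_norm_def)

lemma outflow_singleton:
  assumes "finite E"
  shows "outflow E t h f {v} = (\<Sum>e | e \<in> E \<and> t e = v. f e) - (\<Sum>e | e \<in> E \<and> h e = v. f e)"
proof -
  have "f e * (of_bool (t e \<in> {v}) - of_bool (h e \<in> {v})) =
      (if t e = v then f e else 0) - (if h e = v then f e else 0)" for e
    by simp
  then show ?thesis
    unfolding outflow_def using assms by (simp add: sum_subtractf sum.inter_filter)
qed

text \<open>The integral flows serve as coefficients of \<open>x\<close>, \<open>y\<close>,
  \<open>z\<close>, so each bound reduces to the norms of ten vectors up to sign.\<close>

lemma flow_index_le:
  fixes G :: "('v, 'e) mgraph" and x y z :: "real ^ 'd::finite"
  assumes G: "multigraph G" "bridgeless G" and r: "2 \<le> r"
    and norms: "\<And>i j k :: int. \<bar>i\<bar> \<le> 1 \<Longrightarrow> \<bar>j\<bar> \<le> 1 \<Longrightarrow> \<bar>k\<bar> \<le> 1 \<Longrightarrow> \<bar>j - k\<bar> \<le> 1 \<Longrightarrow>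
      \<not> (i = 0 \<and> j = 0 \<and> k = 0) \<Longrightarrow>
      1 \<le> p_norm p (of_int i *\<^sub>R x + of_int j *\<^sub>R y + of_int k *\<^sub>R z) \<and>
      p_norm p (of_int i *\<^sub>R x + of_int j *\<^sub>R y + of_int k *\<^sub>R z) \<le> r - 1"
  shows "flow_index TYPE('d) p G \<le> ereal r"
proof -
  let ?E = "edges G" and ?V = "vertices G"
  have fin: "finite ?E" "finite ?V" using G(1) by (auto simp: multigraph_def)
  have "\<forall>e\<in>?E. \<exists>u v. ends G e = {u, v}" using G(1) unfolding multigraph_def card_2_iff by metis
  then obtain t h where th: "\<And>e. e \<in> ?E \<Longrightarrow> ends G e = {t e, h e}" by metis
  have ends: "t ` ?E \<subseteq> ?V" "h ` ?E \<subseteq> ?V" using G(1) th by (auto simp: multigraph_def)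
  obtain a b c where flows: "\<And>v. v \<in> ?V \<Longrightarrow> outflow ?E t h a {v} = 0"
      "\<And>v. v \<in> ?V \<Longrightarrow> outflow ?E t h b {v} = 0" "\<And>v. v \<in> ?V \<Longrightarrow> outflow ?E t h c {v} = 0"
    and small: "\<And>e. e \<in> ?E \<Longrightarrow> \<bar>a e\<bar> \<le> 1 \<and> \<bar>b e\<bar> \<le> 1 \<and> \<bar>c e\<bar> \<le> 1 \<and> \<bar>b e - c e\<bar> \<le> 1"
    and nz: "\<And>e. e \<in> ?E \<Longrightarrow> \<not> (a e = 0 \<and> b e = 0 \<and> c e = 0)"
    using bridgeless_integral_flows[OF fin ends bridgeless_cut_edges[OF G th]] by blast
  define D where "D = \<lparr>verts = ?V, arcs = ?E, tail = t, head = h\<rparr>"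
  define f where "f e = of_int (a e) *\<^sub>R x + of_int (b e) *\<^sub>R y + of_int (c e) *\<^sub>R z" for e
  have bounds: "1 \<le> p_norm p (f e) \<and> p_norm p (f e) \<le> r - 1" if "e \<in> ?E" for e
    unfolding f_def using small[OF that] nz[OF that] by (intro norms) auto
  have "f e \<noteq> 0" if "e \<in> ?E" for e
  proof
    assume "f e = 0"
    then show False using bounds[OF that] p_norm_zero[where 'd='d, of p] by auto
  qed
  moreover have "(\<Sum>e\<in>out_arcs D v. f e) - (\<Sum>e\<in>in_arcs D v. f e) = 0" if v: "v \<in> ?V" for v
  proof -
    have arcs: "out_arcs D v = {e. e \<in> ?E \<and> t e = v}" "in_arcs D v = {e. e \<in> ?E \<and> h e = v}"
      by (auto simp: D_def out_arcs_def in_arcs_def)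
    have sums: "(\<Sum>e\<in>A. f e) = of_int (\<Sum>e\<in>A. a e) *\<^sub>R x + of_int (\<Sum>e\<in>A. b e) *\<^sub>R y + of_int (\<Sum>e\<in>A. c e) *\<^sub>R z" for A
      by (simp add: f_def sum.distrib scaleR_left.sum)
    show ?thesis
      using flows[OF v] unfolding outflow_singleton[OF fin(1)] arcs sums by simp
  qed
  moreover have "orientation G D" using th by (simp add: orientation_def D_def)
  ultimately have "nzf r p G D f" using r bounds by (simp add: nzf_def vector_flow_def)
  then show ?thesis unfolding flow_index_def by (intro Inf_lower) blast
qed

section \<open>Choices of the three vectors\<close>

lemma root_powr_bounds:
  fixes s c P :: real
  assumes "1 \<le> P" "1 \<le> s" "s \<le> c powr P" "0 \<le> c"
  shows "1 \<le> s powr (1 / P) \<and> s powr (1 / P) \<le> c"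
proof
  show "1 \<le> s powr (1 / P)" using assms by (simp add: ge_one_powr_ge_zero)
  have "s powr (1 / P) \<le> (c powr P) powr (1 / P)" using assms by (intro powr_mono2) auto
  also have "\<dots> = c" using assms by (simp add: powr_powr)
  finally show "s powr (1 / P) \<le> c" .
qed

lemma p_norm_real:
  "p_norm (ereal P) (x :: real ^ 'd) = (\<Sum>i\<in>UNIV. \<bar>x $ i\<bar> powr P) powr (1 / P)"
  by (simp add: p_norm_def)

lemma p_norm_infinity_2: "p_norm \<infinity> (x :: real ^ 2) = max \<bar>x $ 1\<bar> \<bar>x $ 2\<bar>"
  by (simp add: p_norm_def UNIV_2)

lemma p_norm_infinity_3: "p_norm \<infinity> (x :: real ^ 3) = max \<bar>x $ 1\<bar> (max \<bar>x $ 2\<bar> \<bar>x $ 3\<bar>)"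
  by (simp add: p_norm_def UNIV_3)

text \<open>The condition on \<open>j - k\<close> rules out just the pairs \<open>(1, -1)\<close>
  and \<open>(-1, 1)\<close>.\<close>

lemma small_int_triple_cases:
  fixes i j k :: int
  assumes "\<bar>i\<bar> \<le> 1" "\<bar>j\<bar> \<le> 1" "\<bar>k\<bar> \<le> 1" "\<bar>j - k\<bar> \<le> 1" "\<not> (i = 0 \<and> j = 0 \<and> k = 0)"
  obtains "i \<in> {-1, 0, 1}" "(j, k) \<in> {(1, 0), (-1, 0), (0, 1), (0, -1), (1, 1), (-1, -1)}"
    | "i \<in> {-1, 1}" "j = 0" "k = 0"
proof -
  have "i \<in> {-1, 0, 1}" "j \<in> {-1, 0, 1}" "k \<in> {-1, 0, 1}" using assms(1-3) by auto
  then show ?thesis using that assms(4,5) by auto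
qed

text \<open>The height that makes the side \<open>(1/2, t)\<close> of a triangle with unit base a
  unit vector; it is positive because \<open>(1/2) powr P \<le> 1/2\<close>.\<close>

lemma apex_height:
  fixes P :: real
  assumes "1 \<le> P"
  obtains t where "0 < t" "t powr P = 1 - (1 / 2) powr P"
proof -
  have "(1 / 2) powr P \<le> (1 / 2 :: real) powr 1" using assms by (intro powr_mono') auto
  then have le: "(1 / 2 :: real) powr P \<le> 1 / 2" by simp
  have "P \<noteq> 0" using assms by simp
  show ?thesis
  proof
    let ?t = "(1 - (1 / 2) powr P) powr (1 / P)"
    show "0 < ?t" using \<open>P \<noteq> 0\<close> le by simp
    show "?t powr P = 1 - (1 / 2) powr P" using \<open>P \<noteq> 0\<close> le by (simp add: powr_powr)
  qed
qed

text \<open>Bounds the norm of \<open>(3/2, t)\<close> by 2. Both 1 and 3/2 are convex combinations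
  of 1/2 and 2, and the two weights of each endpoint add up to 1.\<close>

lemma three_halves_powr_bound:
  fixes P :: real
  assumes "1 \<le> P"
  shows "(3 / 2) powr P + 1 \<le> 2 powr P + (1 / 2) powr P"
proof -
  note conv = powr_convex[OF assms]
  have "(3 / 2) powr P \<le> 1 / 3 * (1 / 2) powr P + 2 / 3 * 2 powr P"
    using convex_onD[OF conv, of "2 / 3" "1 / 2" 2] by simp
  moreover have "1 powr P \<le> 2 / 3 * (1 / 2) powr P + 1 / 3 * 2 powr P"
    using convex_onD[OF conv, of "1 / 3" "1 / 2" 2] by simp
  ultimately show ?thesis by simp
qed

text \<open>Up to signs of coordinates, only \<open>(1/2, t)\<close>, \<open>(3/2, t)\<close>,
  \<open>(0, 2 * t)\<close>, \<open>(1, 2 * t)\<close> and \<open>(1, 0)\<close> occur.\<close>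

lemma p_norm_plane_bounds:
  assumes P: "1 \<le> P" and t: "0 < t" "t powr P = 1 - (1 / 2) powr P"
    and ijk: "\<bar>i :: int\<bar> \<le> 1" "\<bar>j\<bar> \<le> 1" "\<bar>k\<bar> \<le> 1" "\<bar>j - k\<bar> \<le> 1" "\<not> (i = 0 \<and> j = 0 \<and> k = 0)"
  defines "x \<equiv> of_int i *\<^sub>R vector [1, 0] + of_int j *\<^sub>R vector [1 / 2, t] +
    of_int k *\<^sub>R vector [- 1 / 2, t] :: real ^ 2"
  shows "1 \<le> p_norm (ereal P) x \<and> p_norm (ereal P) x \<le> 2"
proof -
  let ?H = "(1 / 2) powr P" and ?B = "2 powr P" and ?A = "(3 / 2) powr P"
  have B: "2 \<le> ?B" using powr_mono[of 1 P 2] P by simp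
  have A: "1 \<le> ?A" using P by (intro ge_one_powr_ge_zero) auto
  have "?B * ?H = 1" using powr_mult[of 2 "1 / 2" P] by simp
  \<comment> \<open>The power sums of \<open>(0, 2 * t)\<close> and \<open>(1, 2 * t)\<close> are
    thus \<open>2 powr P - 1\<close> and \<open>2 powr P\<close>; the latter attains norm 2.\<close>
  then have tt: "(2 * t) powr P = ?B - 1" using t by (simp add: powr_mult right_diff_distrib)
  have H: "0 \<le> ?H" "?H \<le> 1" using P t(2) by (auto simp: powr_le1)
  have "1 \<le> \<bar>x $ 1\<bar> powr P + \<bar>x $ 2\<bar> powr P \<and> \<bar>x $ 1\<bar> powr P + \<bar>x $ 2\<bar> powr P \<le> ?B"
    using ijk
  proof (cases rule: small_int_triple_cases)
    case 1
    then have "\<bar>x $ 1\<bar> \<in> {1 / 2, 3 / 2} \<and> \<bar>x $ 2\<bar> = t \<or> \<bar>x $ 1\<bar> \<in> {0, 1} \<and> \<bar>x $ 2\<bar> = 2 * t"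
      using t(1) by (auto simp: x_def)
    then show ?thesis
    proof (elim disjE conjE)
      assume "\<bar>x $ 1\<bar> \<in> {1 / 2, 3 / 2}" "\<bar>x $ 2\<bar> = t"
      then show ?thesis using three_halves_powr_bound[OF P] B A H unfolding insert_iff empty_iff
        by (elim disjE) (simp_all only: t(2), linarith+)
    next
      assume "\<bar>x $ 1\<bar> \<in> {0, 1}" "\<bar>x $ 2\<bar> = 2 * t"
      then show ?thesis using B unfolding insert_iff empty_iff
        by (elim disjE) (simp_all add: tt)
    qed
  next
    case 2
    then have "\<bar>x $ 1\<bar> = 1" "\<bar>x $ 2\<bar> = 0" by (auto simp: x_def)
    then show ?thesis using B by simp
  qed
  then show ?thesis unfolding p_norm_real sum_2 using P by (intro root_powr_bounds) auto
qed

text \<open>The second and third vectors and their sum have power sum 1; adding or subtracting the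
  first raises it to 2.\<close>

lemma p_norm_space_bounds:
  assumes P: "1 \<le> P" and t: "0 < t" "t powr P = 1 - (1 / 2) powr P"
    and ijk: "\<bar>i :: int\<bar> \<le> 1" "\<bar>j\<bar> \<le> 1" "\<bar>k\<bar> \<le> 1" "\<bar>j - k\<bar> \<le> 1" "\<not> (i = 0 \<and> j = 0 \<and> k = 0)"
  defines "x \<equiv> of_int i *\<^sub>R vector [0, 0, 1] + of_int j *\<^sub>R vector [1, 0, 0] +
    of_int k *\<^sub>R vector [- 1 / 2, t, 0] :: real ^ 3"
  shows "1 \<le> p_norm (ereal P) x \<and> p_norm (ereal P) x \<le> 2 powr (1 / P)"
proof -
  have "1 \<le> \<bar>x $ 1\<bar> powr P + \<bar>x $ 2\<bar> powr P + \<bar>x $ 3\<bar> powr P \<and>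
      \<bar>x $ 1\<bar> powr P + \<bar>x $ 2\<bar> powr P + \<bar>x $ 3\<bar> powr P \<le> 2"
    using ijk
  proof (cases rule: small_int_triple_cases)
    case 1
    then have "\<bar>x $ 1\<bar> = 1 \<and> \<bar>x $ 2\<bar> = 0 \<or> \<bar>x $ 1\<bar> = 1 / 2 \<and> \<bar>x $ 2\<bar> = t"
      using t(1) by (auto simp: x_def)
    then have "\<bar>x $ 1\<bar> powr P + \<bar>x $ 2\<bar> powr P = 1"
      by (elim disjE conjE) (simp_all only: t(2), simp_all)
    moreover have "\<bar>x $ 3\<bar> = 0 \<or> \<bar>x $ 3\<bar> = 1" using 1(1) by (auto simp: x_def)
    then have "\<bar>x $ 3\<bar> powr P \<in> {0, 1}" by (elim disjE) simp_all
    ultimately show ?thesis by auto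
  next
    case 2
    then have "\<bar>x $ 1\<bar> = 0" "\<bar>x $ 2\<bar> = 0" "\<bar>x $ 3\<bar> = 1" by (auto simp: x_def)
    then show ?thesis by simp
  qed
  then show ?thesis
    unfolding p_norm_real sum_3 using P by (intro root_powr_bounds) (auto simp: powr_powr)
qed

text \<open>The height 1 is the limit of \<open>t\<close> as \<open>P\<close> tends to
  infinity.\<close>

lemma infinity_norm_plane_bounds:
  assumes ijk: "\<bar>i :: int\<bar> \<le> 1" "\<bar>j\<bar> \<le> 1" "\<bar>k\<bar> \<le> 1" "\<bar>j - k\<bar> \<le> 1" "\<not> (i = 0 \<and> j = 0 \<and> k = 0)"
  defines "x \<equiv> of_int i *\<^sub>R vector [1, 0] + of_int j *\<^sub>R vector [1 / 2, 1] +
    of_int k *\<^sub>R vector [- 1 / 2, 1] :: real ^ 2"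
  shows "1 \<le> p_norm \<infinity> x \<and> p_norm \<infinity> x \<le> 2"
  using ijk
  by (cases rule: small_int_triple_cases) (auto simp: p_norm_infinity_2 x_def)

lemma infinity_norm_space_bounds:
  assumes ijk: "\<bar>i :: int\<bar> \<le> 1" "\<bar>j\<bar> \<le> 1" "\<bar>k\<bar> \<le> 1" "\<bar>j - k\<bar> \<le> 1" "\<not> (i = 0 \<and> j = 0 \<and> k = 0)"
  defines "x \<equiv> of_int i *\<^sub>R vector [0, 0, 1] + of_int j *\<^sub>R vector [1, 0, 0] +
    of_int k *\<^sub>R vector [- 1 / 2, 1, 0] :: real ^ 3"
  shows "1 \<le> p_norm \<infinity> x \<and> p_norm \<infinity> x \<le> 1"
  using ijk
  by (cases rule: small_int_triple_cases) (auto simp: p_norm_infinity_3 x_def)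

text \<open>The three vectors were found by a numerical search.\<close>

lemma one_norm_space_bounds:
  assumes ijk: "\<bar>i :: int\<bar> \<le> 1" "\<bar>j\<bar> \<le> 1" "\<bar>k\<bar> \<le> 1" "\<bar>j - k\<bar> \<le> 1" "\<not> (i = 0 \<and> j = 0 \<and> k = 0)"
  defines "x \<equiv> of_int i *\<^sub>R vector [- 1 / 4, - 3 / 8, - 3 / 8] +
    of_int j *\<^sub>R vector [- 1 / 2, - 1 / 8, 3 / 8] +
    of_int k *\<^sub>R vector [1 / 2, - 3 / 8, 1 / 8] :: real ^ 3"
  shows "1 \<le> p_norm 1 x \<and> p_norm 1 x \<le> 5 / 4"
proof -
  have "p_norm 1 x = \<bar>x $ 1\<bar> + \<bar>x $ 2\<bar> + \<bar>x $ 3\<bar>"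
    using p_norm_real[of 1 x] by (simp add: sum_3 one_ereal_def)
  \<comment> \<open>All three vectors and the sum of the last two have norm 1; adding the first to,
    or subtracting it from, the second, the third or their sum gives exactly 5/4.\<close>
  moreover have "1 \<le> \<bar>x $ 1\<bar> + \<bar>x $ 2\<bar> + \<bar>x $ 3\<bar> \<and> \<bar>x $ 1\<bar> + \<bar>x $ 2\<bar> + \<bar>x $ 3\<bar> \<le> 5 / 4"
    using ijk by (cases rule: small_int_triple_cases) (auto simp: x_def)
  ultimately show ?thesis by simp
qed

section \<open>Bounds on the flow indices\<close>

lemma flow_index_2_le:
  assumes G: "multigraph G" "bridgeless G" and p: "1 \<le> p"
  shows "flow_index TYPE(2) p G \<le> 3"
proof -
  have "flow_index TYPE(2) p G \<le> ereal 3"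
  proof (cases p)
    case (real P)
    then have P: "1 \<le> P" using p by simp
    obtain t where t: "0 < t" "t powr P = 1 - (1 / 2) powr P" using apex_height[OF P] by blast
    show ?thesis
      unfolding real by (rule flow_index_le[OF G]) (use p_norm_plane_bounds[OF P t] in simp_all)
  next
    case PInf
    show ?thesis
      unfolding PInf by (rule flow_index_le[OF G]) (use infinity_norm_plane_bounds in simp_all)
  qed (use p in auto)
  then show ?thesis by simp
qed

lemma flow_index_3_infinity_le:
  assumes "multigraph G" "bridgeless G"
  shows "flow_index TYPE(3) \<infinity> G \<le> ereal 2"
  by (rule flow_index_le[OF assms]) (use infinity_norm_space_bounds in simp_all)

lemma flow_index_3_le:
  assumes G: "multigraph G" "bridgeless G" and p: "1 \<le> p"
  shows "flow_index TYPE(3) p G \<le> ereal (1 + 2 powr real_of_ereal (1 / p))"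
proof (cases p)
  case (real P)
  then have P: "1 \<le> P" using p by simp
  obtain t where t: "0 < t" "t powr P = 1 - (1 / 2) powr P" using apex_height[OF P] by blast
  have ge: "1 \<le> (2 :: real) powr (1 / P)" using P by (intro ge_one_powr_ge_zero) auto
  have "flow_index TYPE(3) p G \<le> ereal (1 + 2 powr (1 / P))"
    unfolding real by (rule flow_index_le[OF G]) (use ge p_norm_space_bounds[OF P t] in simp_all)
  moreover have "real_of_ereal (1 / p) = 1 / P" using P by (simp add: real one_ereal_def)
  ultimately show ?thesis by simp
next
  case PInf
  \<comment> \<open>\<open>1 / \<infinity>\<close> is 0, so the bound reads
    \<open>1 + 2 powr 0 = 2\<close>.\<close>
  then show ?thesis using flow_index_3_infinity_le[OF G] by simp
qed (use p in auto)

lemma flow_index_3_1_le: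
  assumes "multigraph G" "bridgeless G"
  shows "flow_index TYPE(3) 1 G \<le> ereal (9 / 4)"
  by (rule flow_index_le[OF assms]) (use one_norm_space_bounds in simp_all)

lemma flow_index_ge: "2 \<le> flow_index TYPE('d::finite) p G"
  unfolding flow_index_def by (intro Inf_greatest) (auto simp: nzf_def)

theorem theorem1p7:
  fixes G :: "('v, 'e) mgraph"
  assumes "multigraph G" and "bridgeless G"
  shows "(\<forall>p::ereal. 1 \<le> p \<longrightarrow> flow_index TYPE(2) p G \<le> 3) \<and>
    (\<forall>p::ereal. 1 \<le> p \<longrightarrow> flow_index TYPE(3) p G \<le> ereal (1 + 2 powr real_of_ereal (1 / p))) \<and>
    flow_index TYPE(3) \<infinity> G = 2 \<and>
    flow_index TYPE(3) 1 G \<le> ereal (9 / 4)"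
proof -
  have "flow_index TYPE(3) \<infinity> G = 2"
    using flow_index_3_infinity_le[OF assms] flow_index_ge[where 'd = 3 and p = \<infinity> and G = G]
    by (auto intro: order.antisym)
  then show ?thesis
    using flow_index_2_le[OF assms] flow_index_3_le[OF assms] flow_index_3_1_le[OF assms] by blast
qed

end
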